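(* Let $D\subset\mathbb{R}^2$ be a bounded simply connected domain, let $\lambda,\mu$ be Lamé constants, and let $g_1,g_2\colon\partial D\to\mathbb{R}$ be given functions. (i) Let $W$ be a general biharmonic function in $\mathcal{C}^2(\mathrm{cl}D)$ satisfying the boundary conditions $$\mathrm{C}_k[W](x_0,y_0)=2\mu\,g_k(x_0,y_0),\quad k=1,2,\qquad\text{for all }(x_0,y_0)\in\partial D.$$ Then $W$ yields the general solution of the $(u_x,v_y)$-problem with boundary data $g_1,g_2$ by the formulas $2\mu\,\mathcal{V}_k(x,y)=\mathrm{C}_k[W](x,y)$, $k=1,2$, $(x,y)\in D$. (ii) Let $\Phi$ be a general solution of the (1-4)-problem with boundary data $$u_1=\lambda\,g_1+(\lambda+2\mu)\,g_2,\qquad u_4=-\mu\,g_1+\mu\,g_2 .$$ Then $\Phi$ generates in $D$ the second order derivatives $\frac{\partial^2W}{\partial x^2}$, $\frac{\partial^2W}{\partial y^2}$ of the function $W$ in (i) by the formulas $$\frac{\partial^2W(x,y)}{\partial x^2}=\mathrm{U}_1[\Phi(\zeta)],\qquad\frac{\partial^2W(x,y)}{\partial y^2}=\mathrm{U}_1[\Phi(\zeta)]-2\,\mathrm{U}_4[\Phi(\zeta)],\qquad \zeta=xe_1+ye_2,\ (x,y)\in D,$$ and the general solution $\mathcal{V}_1=\frac{\partial u}{\partial x}$, $\mathcal{V}_2=\frac{\partial v}{\partial y}$ of the $(u_x,v_y)$-problem with boundary data $g_1,g_2$ is expressed, for every $(x,y)\in\mathrm{cl}D$ and $\zeta=xe_1+ye_2\in\mathrm{cl}D_\zeta$,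 by $$2\mu\frac{\partial u(x,y)}{\partial x}=\frac{\mu}{\lambda+\mu}\,\mathrm{U}_1[\Phi(\zeta)]-\frac{\lambda+2\mu}{\lambda+\mu}\,\mathrm{U}_4[\Phi(\zeta)],$$ $$2\mu\frac{\partial v(x,y)}{\partial y}=\frac{\mu}{\lambda+\mu}\,\mathrm{U}_1[\Phi(\zeta)]+\frac{\lambda}{\lambda+\mu}\,\mathrm{U}_4[\Phi(\zeta)].$$
   Context: Meaning of "general solution": in (i), every such $W$ gives a solution of the $(u_x,v_y)$-problem by the stated formulas, and every solution of the $(u_x,v_y)$-problem is obtained in this way from some such $W$. In (ii), for a solution $\Phi$ of the stated (1-4)-problem, there is a function $W$ as in (i) with the stated second derivatives, and any such $W$ has these second derivatives; the stated pair $\mathcal{V}_1,\mathcal{V}_2$ solves the $(u_x,v_y)$-problem and every solution of that problem is given by these formulas. Algebra. $\mathbb{B}$ is the two-dimensional commutative associative algebra with unit over $\mathbb{C}$ with basis $\{e_1,e_2\}$ and multiplication $e_1=1$, $e_2^2=e_1+2ie_2$, where $i$ is the imaginary unit of $\mathbb{C}$. The biharmonic plane is $P:=\{xe_1+ye_2:x,y\in\mathbb{R}\}$; every nonzero element of $P$ is invertible in $\mathbb{B}$. Put $D_\zeta:=\{xe_1+ye_2:(x,y)\in D\}\subset P$. A function $\Phi\colon D_\zeta\to\mathbb{B}$ is monogenic, $\Phi\in\mathcal{M}_{\mathbb{B}}(D_\zeta)$, if $\Phi'(\zeta):=\lim_{h\to0,\,h\in P}(\Phi(\zeta+h)-\Phi(\zeta))h^{-1}$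 exists at every $\zeta\in D_\zeta$. Every $\Phi\colon D_\zeta\to\mathbb{B}$ is uniquely written as $\Phi(\zeta)=U_1(x,y)e_1+U_2(x,y)ie_1+U_3(x,y)e_2+U_4(x,y)ie_2$, $\zeta=xe_1+ye_2$, with $U_k\colon D\to\mathbb{R}$, and $\mathrm{U}_k[\Phi(\zeta)]:=U_k(x,y)$. Boundary values. $\mathrm{cl}$ and $\partial$ denote closure and boundary. For a continuous $\tau\colon D\to\mathbb{R}$ one writes $\tau\in\mathcal{C}(\mathrm{cl}D)$ if for every $(x_0,y_0)\in\partial D$ the finite limit $\tau(x,y)|_{(x_0,y_0)}:=\lim_{(x,y)\in D,\,(x,y)\to(x_0,y_0)}\tau(x,y)$ exists; functions in $\mathcal{C}(\mathrm{cl}D)$ are extended to $\partial D$ by these limits. $\Phi\in\mathcal{C}(\mathrm{cl}D_\zeta)$ means $\mathrm{U}_k[\Phi]\in\mathcal{C}(\mathrm{cl}D)$ for $k=1,\dots,4$; then $\mathrm{U}_k[\Phi(\zeta_0)]$, $\zeta_0\in\partial D_\zeta$, denotes the corresponding limit. For a biharmonic function $W$ in $D$, $W\in\mathcal{C}^2(\mathrm{cl}D)$ means that $\frac{\partial^2W}{\partial x^2},\frac{\partial^2W}{\partial y^2}$ (hence also $\Delta_2W$) belong to $\mathcal{C}(\mathrm{cl}D)$. Here $\Delta_2=\frac{\partial^2}{\partial x^2}+\frac{\partial^2}{\partial y^2}$, and $W\colon D\to\mathbb{R}$ is biharmonic if $(\Delta_2)^2W=0$ in $D$. The (1-4)-problem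 with data $u_1,u_4\colon\partial D_\zeta\to\mathbb{R}$ (functions on $\partial D$ and $\partial D_\zeta$ being identified via $(x,y)\leftrightarrow xe_1+ye_2$): find $\Phi\in\mathcal{M}_{\mathbb{B}}(D_\zeta)\cap\mathcal{C}(\mathrm{cl}D_\zeta)$ with $\mathrm{U}_k[\Phi(\zeta_0)]=u_k(\zeta_0)$ for $k\in\{1,4\}$ and all $\zeta_0\in\partial D_\zeta$. Elasticity. The Lamé constants are real numbers with $\mu>0$, $\lambda+\mu>0$. Displacements of an elastic isotropic body occupying $D$ (plane strain, no body forces) are pairs $u,v\colon D\to\mathbb{R}$ of class $\mathcal C^2$ satisfying the Lamé equilibrium system $\Delta_2u+\gamma\frac{\partial\theta}{\partial x}=0$, $\Delta_2v+\gamma\frac{\partial\theta}{\partial y}=0$, where $\theta=\frac{\partial u}{\partial x}+\frac{\partial v}{\partial y}$ and $\gamma=(\lambda+\mu)/\mu$. The $(u_x,v_y)$-problem with data $g_1,g_2$: find in $D$ the partial derivatives $\mathcal{V}_1=\frac{\partial u}{\partial x}$, $\mathcal{V}_2=\frac{\partial v}{\partial y}$ of displacements $u,v$ such that $\mathcal{V}_1,\mathcal{V}_2\in\mathcal{C}(\mathrm{cl}D)$ and $\mathcal{V}_k(x,y)|_{(x_0,y_0)}=g_k(x_0,y_0)$ for $k=1,2$ and all $(x_0,y_0)\in\partial D$. For a biharmonic $W$, put $W_0:=\Delta_2W$, $W_1:=\frac{\partial^2W}{\partial x^2}$, $W_2:=\frac{\partial^2W}{\partial y^2}$, $\kappa_0:=\frac{\lambda+2\mu}{2(\lambda+\mu)}$,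 and $\mathrm{C}_k[W]:=-W_k+\kappa_0W_0$, $k=1,2$. Standard fact of plane elasticity (Airy stress function), taken as known: in a simply connected $D$, a pair $(\mathcal{V}_1,\mathcal{V}_2)$ is of the form $(\frac{\partial u}{\partial x},\frac{\partial v}{\partial y})$ for displacements $u,v$ if and only if $2\mu\mathcal{V}_k=\mathrm{C}_k[W]$ in $D$, $k=1,2$, for some biharmonic $W$ in $D$. *)

theory Defs
  imports "HOL-Analysis.Analysis"
begin

section \<open>The biharmonic algebra\<close>

text \<open>
  \<open>Bih a b\<close> stands for \<open>a e1 + b e2\<close> with complex coefficients \<open>a\<close>, \<open>b\<close>. The product is the one
  determined by \<open>e1 = 1\<close> and \<open>e2 * e2 = e1 + 2 i e2\<close>; the topology is that of \<open>\<complex>\<^sup>2\<close>.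
\<close>

datatype bih = Bih (bc1: complex) (bc2: complex)

lemma bih_eq_iff: "z = w \<longleftrightarrow> bc1 z = bc1 w \<and> bc2 z = bc2 w"
  by (cases z; cases w) simp

instantiation bih :: comm_ring_1
begin

definition zero_bih where "0 = Bih 0 0"
definition one_bih where "1 = Bih 1 0"
definition plus_bih where "z + w = Bih (bc1 z + bc1 w) (bc2 z + bc2 w)"
definition minus_bih where "z - w = Bih (bc1 z - bc1 w) (bc2 z - bc2 w)"
definition uminus_bih where "- z = Bih (- bc1 z) (- bc2 z)"
definition times_bih where
  "z * w = Bih (bc1 z * bc1 w + bc2 z * bc2 w)
               (bc1 z * bc2 w + bc2 z * bc1 w + 2 * \<i> * bc2 z * bc2 w)"

instance
  by standard
    (simp_all add: zero_bih_def one_bih_def plus_bih_def minus_bih_def uminus_bih_def times_bih_def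
      bih_eq_iff algebra_simps)

end

instantiation bih :: inverse
begin

text \<open>
  An element \<open>Bih a b\<close> is invertible iff \<open>a + i b \<noteq> 0\<close>; non-invertible elements are mapped to \<open>0\<close>.
\<close>

definition inverse_bih where
  "inverse z = Bih ((bc1 z + 2 * \<i> * bc2 z) / (bc1 z + \<i> * bc2 z)\<^sup>2)
                   (- bc2 z / (bc1 z + \<i> * bc2 z)\<^sup>2)"
definition divide_bih where "z div w = z * inverse (w :: bih)"

instance ..

end

instantiation bih :: real_normed_vector
begin

definition scaleR_bih where "r *\<^sub>R z = Bih (r *\<^sub>R bc1 z) (r *\<^sub>R bc2 z)"
definition norm_bih where "norm z = norm (bc1 z, bc2 z)"
definition sgn_bih where "sgn (z :: bih) = inverse (norm z) *\<^sub>R z"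
definition dist_bih where "dist z w = norm (z - w :: bih)"
definition uniformity_bih where
  "(uniformity :: (bih \<times> bih) filter) = (INF e\<in>{0 <..}. principal {(x, y). dist x y < e})"
definition open_bih where
  "open (U :: bih set) = (\<forall>x\<in>U. eventually (\<lambda>(x', y). x' = x \<longrightarrow> y \<in> U) uniformity)"

instance
proof
  fix z w :: bih and r s :: real and U :: "bih set"
  show "r *\<^sub>R (z + w) = r *\<^sub>R z + r *\<^sub>R w" "(r + s) *\<^sub>R z = r *\<^sub>R z + s *\<^sub>R z"
    "r *\<^sub>R s *\<^sub>R z = (r * s) *\<^sub>R z" "1 *\<^sub>R z = z"
    by (simp_all add: scaleR_bih_def plus_bih_def bih_eq_iff algebra_simps)
  show "dist z w = norm (z - w)"
    by (simp add: dist_bih_def)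
  show "sgn z = inverse (norm z) *\<^sub>R z"
    by (simp add: sgn_bih_def)
  show "(uniformity :: (bih \<times> bih) filter) = (INF e\<in>{0 <..}. principal {(x, y). dist x y < e})"
    by (simp add: uniformity_bih_def)
  show "open U = (\<forall>x\<in>U. eventually (\<lambda>(x', y). x' = x \<longrightarrow> y \<in> U) uniformity)"
    by (simp add: open_bih_def)
  show "norm z = 0 \<longleftrightarrow> z = 0"
    by (simp add: norm_bih_def zero_bih_def bih_eq_iff prod_eq_iff)
  show "norm (z + w) \<le> norm z + norm w"
    using norm_triangle_ineq[of "(bc1 z, bc2 z)" "(bc1 w, bc2 w)"]
    by (simp add: norm_bih_def plus_bih_def)
  show "norm (r *\<^sub>R z) = \<bar>r\<bar> * norm z"
    using norm_scaleR[of r "(bc1 z, bc2 z)"]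
    by (simp add: norm_bih_def scaleR_bih_def)
qed

end

definition e1 :: bih where "e1 = Bih 1 0"
definition e2 :: bih where "e2 = Bih 0 1"

lemma e1_eq_one: "e1 = 1"
  by (simp add: e1_def one_bih_def)

lemma e2_square: "e2 * e2 = e1 + Bih (2 * \<i>) 0 * e2"
  by (simp add: e1_def e2_def times_bih_def plus_bih_def)

lemma bih_basis: "Bih a b = Bih a 0 * e1 + Bih b 0 * e2"
  by (simp add: e1_def e2_def times_bih_def plus_bih_def)

definition zeta :: "real \<times> real \<Rightarrow> bih" where
  "zeta p = fst p *\<^sub>R e1 + snd p *\<^sub>R e2"

definition bih_plane :: "bih set" where
  "bih_plane = range zeta"

lemma bih_plane_inverse:
  assumes "h \<in> bih_plane" "h \<noteq> 0"
  shows "h * inverse h = 1"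
proof -
  obtain x y :: real where h: "h = Bih (of_real x) (of_real y)"
    using assms(1)
    by (auto simp: bih_plane_def zeta_def e1_def e2_def scaleR_bih_def plus_bih_def scaleR_conv_of_real)
  have "of_real x + \<i> * of_real y \<noteq> (0 :: complex)"
    using assms(2) by (auto simp: h zero_bih_def complex_eq_iff)
  moreover have "of_real x * (of_real x + 2 * \<i> * of_real y) - of_real y * of_real y
      = (of_real x + \<i> * of_real y :: complex)\<^sup>2"
    by (simp add: power2_eq_square algebra_simps)
  ultimately show ?thesis
    by (simp add: h times_bih_def inverse_bih_def one_bih_def flip: add_divide_distrib diff_divide_distrib)
      (simp add: algebra_simps flip: add_divide_distrib diff_divide_distrib)
qed

definition monogenic_on :: "bih set \<Rightarrow> (bih \<Rightarrow> bih) \<Rightarrow> bool" where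
  "monogenic_on S \<Phi> \<longleftrightarrow>
    (\<forall>z\<in>S. \<exists>d. ((\<lambda>h. (\<Phi> (z + h) - \<Phi> z) * inverse h) \<longlongrightarrow> d) (at 0 within bih_plane))"

text \<open>
  The real components of \<open>\<Phi> = U1 e1 + U2 i e1 + U3 e2 + U4 i e2\<close> as functions of \<open>(x, y)\<close>.
\<close>

definition U1 :: "(bih \<Rightarrow> bih) \<Rightarrow> real \<times> real \<Rightarrow> real" where "U1 \<Phi> p = Re (bc1 (\<Phi> (zeta p)))"
definition U2 :: "(bih \<Rightarrow> bih) \<Rightarrow> real \<times> real \<Rightarrow> real" where "U2 \<Phi> p = Im (bc1 (\<Phi> (zeta p)))"
definition U3 :: "(bih \<Rightarrow> bih) \<Rightarrow> real \<times> real \<Rightarrow> real" where "U3 \<Phi> p = Re (bc2 (\<Phi> (zeta p)))"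
definition U4 :: "(bih \<Rightarrow> bih) \<Rightarrow> real \<times> real \<Rightarrow> real" where "U4 \<Phi> p = Im (bc2 (\<Phi> (zeta p)))"

lemma bih_components:
  "\<Phi> (zeta p) = U1 \<Phi> p *\<^sub>R e1 + U2 \<Phi> p *\<^sub>R (Bih \<i> 0 * e1) + U3 \<Phi> p *\<^sub>R e2 + U4 \<Phi> p *\<^sub>R (Bih \<i> 0 * e2)"
  by (simp add: U1_def U2_def U3_def U4_def e1_def e2_def times_bih_def plus_bih_def scaleR_bih_def
      bih_eq_iff complex_eq_iff)


section \<open>Boundary values\<close>

text \<open>\<open>cont_cl D \<tau>\<close> is membership in \<open>C(cl D)\<close> for open \<open>D\<close>: only the values of \<open>\<tau>\<close> on \<open>D\<close> matter.\<close>

definition cont_cl :: "(real \<times> real) set \<Rightarrow> (real \<times> real \<Rightarrow> real) \<Rightarrow> bool" where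
  "cont_cl D \<tau> \<longleftrightarrow> continuous_on D \<tau> \<and> (\<forall>p\<in>frontier D. \<exists>l. (\<tau> \<longlongrightarrow> l) (at p within D))"

definition cl_ext :: "(real \<times> real) set \<Rightarrow> (real \<times> real \<Rightarrow> real) \<Rightarrow> real \<times> real \<Rightarrow> real" where
  "cl_ext D \<tau> p = (if p \<in> D then \<tau> p else Lim (at p within D) \<tau>)"


section \<open>Biharmonic functions\<close>

definition pdx :: "(real \<times> real \<Rightarrow> real) \<Rightarrow> real \<times> real \<Rightarrow> real" where
  "pdx f p = deriv (\<lambda>t. f (t, snd p)) (fst p)"

definition pdy :: "(real \<times> real \<Rightarrow> real) \<Rightarrow> real \<times> real \<Rightarrow> real" where
  "pdy f p = deriv (\<lambda>t. f (fst p, t)) (snd p)"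

text \<open>
  Class \<open>C\<^sup>k\<close> on an open set. The operators \<open>pdx\<close>, \<open>pdy\<close> are total, so existence of the partial
  derivatives has to be required explicitly.
\<close>

primrec Ck_on :: "nat \<Rightarrow> (real \<times> real) set \<Rightarrow> (real \<times> real \<Rightarrow> real) \<Rightarrow> bool" where
  "Ck_on 0 D f \<longleftrightarrow> continuous_on D f"
| "Ck_on (Suc k) D f \<longleftrightarrow>
    continuous_on D f \<and>
    (\<forall>p\<in>D. (\<lambda>t. f (t, snd p)) field_differentiable at (fst p) \<and>
           (\<lambda>t. f (fst p, t)) field_differentiable at (snd p)) \<and>
    Ck_on k D (pdx f) \<and> Ck_on k D (pdy f)"

definition laplace :: "(real \<times> real \<Rightarrow> real) \<Rightarrow> real \<times> real \<Rightarrow> real" where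
  "laplace f p = pdx (pdx f) p + pdy (pdy f) p"

definition biharmonic_on :: "(real \<times> real) set \<Rightarrow> (real \<times> real \<Rightarrow> real) \<Rightarrow> bool" where
  "biharmonic_on D W \<longleftrightarrow> Ck_on 4 D W \<and> (\<forall>p\<in>D. laplace (laplace W) p = 0)"

definition C2_cl :: "(real \<times> real) set \<Rightarrow> (real \<times> real \<Rightarrow> real) \<Rightarrow> bool" where
  "C2_cl D W \<longleftrightarrow> cont_cl D (pdx (pdx W)) \<and> cont_cl D (pdy (pdy W))"


section \<open>Boundary value problems\<close>

definition problem_1_4 ::
  "(real \<times> real) set \<Rightarrow> (real \<times> real \<Rightarrow> real) \<Rightarrow> (real \<times> real \<Rightarrow> real) \<Rightarrow> (bih \<Rightarrow> bih) \<Rightarrow> bool" where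
  "problem_1_4 D u1 u4 \<Phi> \<longleftrightarrow>
    monogenic_on (zeta ` D) \<Phi> \<and>
    cont_cl D (U1 \<Phi>) \<and> cont_cl D (U2 \<Phi>) \<and> cont_cl D (U3 \<Phi>) \<and> cont_cl D (U4 \<Phi>) \<and>
    (\<forall>p\<in>frontier D. cl_ext D (U1 \<Phi>) p = u1 p \<and> cl_ext D (U4 \<Phi>) p = u4 p)"

definition displacements ::
  "(real \<times> real) set \<Rightarrow> real \<Rightarrow> real \<Rightarrow> (real \<times> real \<Rightarrow> real) \<Rightarrow> (real \<times> real \<Rightarrow> real) \<Rightarrow> bool" where
  "displacements D lam \<mu> u v \<longleftrightarrow>
    Ck_on 2 D u \<and> Ck_on 2 D v \<and>
    (let \<theta> = (\<lambda>p. pdx u p + pdy v p); \<gamma> = (lam + \<mu>) / \<mu>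
     in \<forall>p\<in>D. laplace u p + \<gamma> * pdx \<theta> p = 0 \<and> laplace v p + \<gamma> * pdy \<theta> p = 0)"

definition problem_ux_vy ::
  "(real \<times> real) set \<Rightarrow> real \<Rightarrow> real \<Rightarrow> (real \<times> real \<Rightarrow> real) \<Rightarrow> (real \<times> real \<Rightarrow> real) \<Rightarrow>
    (real \<times> real \<Rightarrow> real) \<Rightarrow> (real \<times> real \<Rightarrow> real) \<Rightarrow> bool" where
  "problem_ux_vy D lam \<mu> g1 g2 V1 V2 \<longleftrightarrow>
    (\<exists>u v. displacements D lam \<mu> u v \<and> (\<forall>p\<in>D. V1 p = pdx u p \<and> V2 p = pdy v p)) \<and>
    cont_cl D V1 \<and> cont_cl D V2 \<and>
    (\<forall>p\<in>frontier D. cl_ext D V1 p = g1 p \<and> cl_ext D V2 p = g2 p)"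

definition kappa0 :: "real \<Rightarrow> real \<Rightarrow> real" where
  "kappa0 lam \<mu> = (lam + 2 * \<mu>) / (2 * (lam + \<mu>))"

definition C1 :: "real \<Rightarrow> real \<Rightarrow> (real \<times> real \<Rightarrow> real) \<Rightarrow> real \<times> real \<Rightarrow> real" where
  "C1 lam \<mu> W p = - pdx (pdx W) p + kappa0 lam \<mu> * laplace W p"

definition C2 :: "real \<Rightarrow> real \<Rightarrow> (real \<times> real \<Rightarrow> real) \<Rightarrow> real \<times> real \<Rightarrow> real" where
  "C2 lam \<mu> W p = - pdy (pdy W) p + kappa0 lam \<mu> * laplace W p"

definition biharmonic_problem ::
  "(real \<times> real) set \<Rightarrow> real \<Rightarrow> real \<Rightarrow> (real \<times> real \<Rightarrow> real) \<Rightarrow> (real \<times> real \<Rightarrow> real) \<Rightarrow>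
    (real \<times> real \<Rightarrow> real) \<Rightarrow> bool" where
  "biharmonic_problem D lam \<mu> g1 g2 W \<longleftrightarrow>
    biharmonic_on D W \<and> C2_cl D W \<and>
    (\<forall>p\<in>frontier D. cl_ext D (C1 lam \<mu> W) p = 2 * \<mu> * g1 p \<and>
                    cl_ext D (C2 lam \<mu> W) p = 2 * \<mu> * g2 p)"

end

theory Submission
  imports Defs "HOL-Complex_Analysis.Complex_Analysis"
begin

text \<open>
  Everything is reduced to holomorphic functions. On a simply connected domain the biharmonic
  functions are exactly \<open>Re (a + y b)\<close> with \<open>a\<close>, \<open>b\<close> holomorphic (Goursat). The displacements and
  the monogenic functions have analogous representations by two holomorphic functions, and
  comparing coefficients matches the three families. This yields both directions of the Airy
  correspondence, the regularity of merely \<open>C\<^sup>2\<close> displacements coming from the Cauchy-Riemann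
  equations for dilatation and rotation. For uniqueness, boundary data determine the boundary values
  of \<open>W\<^sub>x\<^sub>x\<close> and \<open>W\<^sub>y\<^sub>y\<close>; by the maximum principle they determine the harmonic function \<open>\<Delta> W\<close>,
  and once \<open>\<Delta> W = 0\<close>, the function \<open>W\<^sub>x\<^sub>x\<close> is harmonic as well.
\<close>

section \<open>The plane as complex numbers\<close>

text \<open>The algebra dictates the form \<open>Re (a + y b)\<close>: \<open>e2 - i\<close> squares
  to zero and a point of the plane is \<open>z + y (e2 - i)\<close>, so a monogenic function is
  \<open>F + (G + y F') (e2 - i)\<close> with \<open>F\<close>, \<open>G\<close> holomorphic, affine
  in \<open>y\<close> like the Goursat form. Matching \<open>W_xx\<close> with \<open>U1\<close>
  asks for \<open>b' = - i F\<close> and \<open>a'' = F - i G\<close>; then the Laplacian of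
  \<open>W\<close> is \<open>2 Re F = 2 (U1 - U4)\<close>, whence \<open>W_yy = U1 - 2 U4\<close>.

  At a boundary point the conditions on \<open>C1\<close> and \<open>C2\<close> are a linear system
  for \<open>(W_xx, W_yy)\<close> with determinant \<open>1 - 2 kappa0 = - mu / (lam + mu)\<close>.
  Its solution is \<open>W_xx = u1\<close>, \<open>W_yy = u1 - 2 u4\<close>, which is the origin of
  the data of the (1-4)-problem.

  Two solutions \<open>W\<close> may differ by \<open>c x y\<close> plus an affine function, so
  uniqueness concerns \<open>W_xx\<close> and \<open>W_yy\<close> only. As the boundary values are
  mere limits, the maximum is sought on a compact superlevel set inside \<open>D\<close>.\<close>

definition cpx :: "real \<times> real \<Rightarrow> complex" where
  "cpx p = Complex (fst p) (snd p)"

definition cdom :: "(real \<times> real) set \<Rightarrow> complex set" where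
  "cdom D = {z. (Re z, Im z) \<in> D}"

lemma Re_cpx [simp]: "Re (cpx p) = fst p" and Im_cpx [simp]: "Im (cpx p) = snd p"
  by (simp_all add: cpx_def)

lemma cpx_mem_cdom [simp]: "cpx p \<in> cdom D \<longleftrightarrow> p \<in> D"
  by (simp add: cdom_def cpx_def)

lemma cdomE:
  assumes "z \<in> cdom D" obtains p where "p \<in> D" "z = cpx p"
  using assms by (intro that[of "(Re z, Im z)"]) (auto simp: cdom_def cpx_def)

lemma bounded_linear_cpx: "bounded_linear cpx"
proof -
  have "bounded_linear (\<lambda>p. of_real (fst p) + \<i> * of_real (snd p) :: complex)"
    by (intro bounded_linear_add bounded_linear_const_mult bounded_linear_fst bounded_linear_snd
        bounded_linear_compose[OF bounded_linear_of_real])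
  moreover have "cpx = (\<lambda>p. of_real (fst p) + \<i> * of_real (snd p))"
    by (auto simp: cpx_def complex_eq_iff)
  ultimately show ?thesis by simp
qed

lemmas continuous_on_cpx [continuous_intros] =
  bounded_linear.continuous_on[OF bounded_linear_cpx]

lemma homeomorphism_cdom:
  "homeomorphism D (cdom D) cpx (\<lambda>z. (Re z, Im z))"
proof (rule homeomorphismI)
  show "continuous_on (cdom D) (\<lambda>z. (Re z, Im z))" "continuous_on D cpx"
    by (intro continuous_intros)+
qed (auto simp: cdom_def cpx_def)

lemma open_cdom:
  assumes "open D" shows "open (cdom D)"
  using open_vimage[OF assms, of "\<lambda>z. (Re z, Im z)"]
  by (simp add: cdom_def vimage_def continuous_on_Pair continuous_on_Re continuous_on_Im)

lemma connected_cdom: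
  assumes "connected D" shows "connected (cdom D)"
proof -
  have "cpx ` D = cdom D" "continuous_on D cpx"
    using homeomorphism_cdom[of D] by (auto simp: homeomorphism_def)
  with connected_continuous_image[of D cpx] assms show ?thesis by simp
qed

text \<open>Simple connectivity is carried along the homeomorphism \<open>cpx\<close>; every
  integration below (of Cauchy-Riemann pairs, of the Laplacian, of the dilatation-rotation function,
  of monogenic components) is a call of this lemma.\<close>

lemma primitive_on_cdom:
  assumes "open D" "simply_connected D" "f holomorphic_on cdom D"
  obtains F where "F holomorphic_on cdom D" "\<And>z. z \<in> cdom D \<Longrightarrow> deriv F z = f z"
proof -
  have "simply_connected (cdom D)"
    using homeomorphism_cdom[of D] assms(2) homeomorphic_def homeomorphic_simply_connected by blast
  then obtain F where F: "\<forall>z. z \<in> cdom D \<longrightarrow> (F has_field_derivative f z) (at z)"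
    using simply_connected_eq_global_primitive[OF open_cdom[OF assms(1)]] assms(3) by blast
  have "F holomorphic_on cdom D"
    using F by (meson field_differentiable_at_within field_differentiable_def holomorphic_onI)
  then show thesis
    using F that DERIV_imp_deriv by blast
qed

section \<open>Partial and total derivatives\<close>

lemma partials_of_total:
  assumes "(f has_derivative (\<lambda>h. fst h * a + snd h * b)) (at p)"
  shows "((\<lambda>t. f (t, snd p)) has_field_derivative a) (at (fst p))"
    "((\<lambda>t. f (fst p, t)) has_field_derivative b) (at (snd p))"
proof -
  have 1: "((\<lambda>t. (t, snd p)) has_derivative (\<lambda>t. (t, 0))) (at (fst p))"
    by (auto intro!: derivative_eq_intros)
  have 2: "((\<lambda>t. (fst p, t)) has_derivative (\<lambda>t. (0, t))) (at (snd p))"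
    by (auto intro!: derivative_eq_intros)
  show "((\<lambda>t. f (t, snd p)) has_field_derivative a) (at (fst p))"
    using has_derivative_compose[OF 1, of f "\<lambda>h. fst h * a + snd h * b"] assms
    by (simp add: has_field_derivative_def mult_commute_abs)
  show "((\<lambda>t. f (fst p, t)) has_field_derivative b) (at (snd p))"
    using has_derivative_compose[OF 2, of f "\<lambda>h. fst h * a + snd h * b"] assms
    by (simp add: has_field_derivative_def mult_commute_abs)
qed

lemma pdx_pdy_of_total:
  assumes "(f has_derivative (\<lambda>h. fst h * a + snd h * b)) (at p)"
  shows "pdx f p = a" "pdy f p = b"
  using partials_of_total[OF assms] by (auto simp: pdx_def pdy_def intro: DERIV_imp_deriv)

lemma eventually_horizontal:
  assumes "open D" "p \<in> D" shows "eventually (\<lambda>t. (t, snd p) \<in> D) (nhds (fst p))"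
proof -
  have "open ((\<lambda>t. (t, snd p)) -` D)" by (intro open_vimage assms continuous_intros)
  then show ?thesis using assms(2) by (auto simp: eventually_nhds)
qed

lemma eventually_vertical:
  assumes "open D" "p \<in> D" shows "eventually (\<lambda>t. (fst p, t) \<in> D) (nhds (snd p))"
proof -
  have "open ((\<lambda>t. (fst p, t)) -` D)" by (intro open_vimage assms continuous_intros)
  then show ?thesis using assms(2) by (auto simp: eventually_nhds)
qed

lemma pdx_pdy_cong:
  assumes "open D" "p \<in> D" "\<And>q. q \<in> D \<Longrightarrow> f q = g q"
  shows "pdx f p = pdx g p" "pdy f p = pdy g p"
  unfolding pdx_def pdy_def
  by (rule deriv_cong_ev[OF eventually_mono[OF eventually_horizontal[OF assms(1,2)]] refl];
      simp add: assms(3))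
    (rule deriv_cong_ev[OF eventually_mono[OF eventually_vertical[OF assms(1,2)]] refl];
      simp add: assms(3))

lemma field_differentiable_cong_ev:
  assumes "eventually (\<lambda>x. f x = g x) (nhds x)"
  shows "f field_differentiable at x \<longleftrightarrow> g field_differentiable at x"
  unfolding field_differentiable_def using DERIV_cong_ev[OF refl assms refl] by simp

text \<open>Formulas for partial derivatives are known on \<open>D\<close> only, while
  \<open>pdx\<close> and \<open>pdy\<close> are total operators. Openness makes them depend on the
  values in \<open>D\<close> alone, so such formulas may be substituted inside
  \<open>Ck_on\<close>.\<close>

lemma Ck_on_cong:
  assumes "open D" "\<And>q. q \<in> D \<Longrightarrow> f q = g q"
  shows "Ck_on k D f \<longleftrightarrow> Ck_on k D g"
  using assms(2)
proof (induction k arbitrary: f g)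
  case 0
  then show ?case by (simp cong: continuous_on_cong)
next
  case (Suc k)
  have "continuous_on D f \<longleftrightarrow> continuous_on D g"
    using Suc.prems by (simp cong: continuous_on_cong)
  moreover have "(\<lambda>t. f (t, snd p)) field_differentiable at (fst p) \<longleftrightarrow>
      (\<lambda>t. g (t, snd p)) field_differentiable at (fst p)" if "p \<in> D" for p
    by (rule field_differentiable_cong_ev)
      (use eventually_horizontal[OF assms(1) that] Suc.prems in \<open>auto elim!: eventually_mono\<close>)
  moreover have "(\<lambda>t. f (fst p, t)) field_differentiable at (snd p) \<longleftrightarrow>
      (\<lambda>t. g (fst p, t)) field_differentiable at (snd p)" if "p \<in> D" for p
    by (rule field_differentiable_cong_ev)
      (use eventually_vertical[OF assms(1) that] Suc.prems in \<open>auto elim!: eventually_mono\<close>)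
  moreover have "Ck_on k D (pdx f) \<longleftrightarrow> Ck_on k D (pdx g)" "Ck_on k D (pdy f) \<longleftrightarrow> Ck_on k D (pdy g)"
    by (intro Suc.IH pdx_pdy_cong[OF assms(1)] Suc.prems; assumption)+
  ultimately show ?case by auto
qed

lemma Ck_on_SucD: "Ck_on (Suc k) D f \<Longrightarrow> Ck_on k D f"
proof (induction k arbitrary: f)
  case 0
  then show ?case by simp
next
  case (Suc k)
  then show ?case unfolding Ck_on.simps(2)[of "Suc k"] Ck_on.simps(2)[of k D f] by blast
qed

lemma Ck_on_has_partials:
  assumes "Ck_on (Suc k) D f" "p \<in> D"
  shows "((\<lambda>t. f (t, snd p)) has_field_derivative pdx f p) (at (fst p))"
    "((\<lambda>t. f (fst p, t)) has_field_derivative pdy f p) (at (snd p))"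
  using assms by (auto simp: pdx_def pdy_def DERIV_deriv_iff_field_differentiable)

lemma Ck_on_continuous_partials:
  assumes "Ck_on (Suc k) D f"
  shows "continuous_on D (pdx f)" "continuous_on D (pdy f)"
  using assms by (cases k; simp)+

section \<open>Continuous partial derivatives: total differentiability and symmetry of second
  derivatives\<close>

lemma C1_has_derivative:
  assumes "open D" "Ck_on (Suc k) D f" "p \<in> D"
  shows "(f has_derivative (\<lambda>h. fst h * pdx f p + snd h * pdy f p)) (at p)"
proof -
  obtain x y where p: "p = (x, y)" by (cases p)
  obtain A B where AB: "open A" "open B" "x \<in> A" "y \<in> B" "A \<times> B \<subseteq> D"
    using assms(1,3) p open_prod_elim by (metis mem_Sigma_iff)
  obtain e where e: "e > 0" "ball y e \<subseteq> B" using AB openE by blast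
  \<comment> \<open>The second factor has to be convex, because the criterion via partial
    derivatives applies a mean value estimate in the \<open>y\<close> direction; a ball inside
    \<open>B\<close> serves.\<close>
  define Y where "Y = ball y e"
  have Y: "open Y" "convex Y" "y \<in> Y" "A \<times> Y \<subseteq> D"
    using e AB(5) by (auto simp: Y_def)
  have opn: "open (A \<times> Y)" using AB Y by (simp add: open_Times)
  let ?fy = "\<lambda>x y. blinfun_scaleR_left (pdy f (x, y))"
  have fx: "((\<lambda>x. f (x, y)) has_derivative (\<lambda>t. t * pdx f (x, y))) (at x within A)"
    using Ck_on_has_partials(1)[OF assms(2,3)]
    unfolding p has_field_derivative_def mult_commute_abs fst_conv snd_conv
    by (rule has_derivative_at_withinI)
  have fy: "((\<lambda>y. f (x, y)) has_derivative blinfun_apply (?fy x y)) (at y within Y)"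
    if "x \<in> A" "y \<in> Y" for x y
  proof (rule has_derivative_at_withinI)
    have "(x, y) \<in> D" using that Y(4) by blast
    then have "((\<lambda>y. f (x, y)) has_derivative (*) (pdy f (x, y))) (at y)"
      using Ck_on_has_partials(2)[OF assms(2), of "(x, y)"] by (simp add: has_field_derivative_def)
    moreover have "blinfun_apply (?fy x y) = (*) (pdy f (x, y))"
      by (intro ext) (simp only: blinfun_scaleR_left.rep_eq real_scaleR_def mult.commute)
    ultimately show "((\<lambda>y. f (x, y)) has_derivative blinfun_apply (?fy x y)) (at y)" by metis
  qed
  have "continuous (at (x, y)) (pdy f)"
    using Ck_on_continuous_partials(2)[OF assms(2)] assms(1,3) p
    by (simp add: continuous_on_eq_continuous_at)
  then have "continuous (at (x, y)) (\<lambda>q. blinfun_scaleR_left (pdy f q))"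
    by (rule bounded_linear.continuous[OF bounded_linear_blinfun_scaleR_left])
  then have "continuous (at (x, y) within A \<times> Y) (\<lambda>q. blinfun_scaleR_left (pdy f q))"
    by (rule continuous_at_imp_continuous_at_within)
  then have cont: "continuous (at (x, y) within A \<times> Y) (\<lambda>(x, y). ?fy x y)"
    by (simp add: case_prod_beta')
  have "((\<lambda>(x, y). f (x, y)) has_derivative
      (\<lambda>(tx, ty). tx * pdx f (x, y) + blinfun_apply (?fy x y) ty)) (at (x, y) within A \<times> Y)"
    by (rule has_derivative_partialsI[where f = "\<lambda>x y. f (x, y)", OF fx fy cont Y(3,2)])
  then show ?thesis
    using AB(3) Y(3) at_within_open[OF _ opn, of "(x, y)"]
    by (simp add: p case_prod_beta')
qed

lemma C1_zero_gradient_constant: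
  assumes "open D" "connected D" "Ck_on (Suc k) D f"
    and "\<And>p. p \<in> D \<Longrightarrow> pdx f p = 0" "\<And>p. p \<in> D \<Longrightarrow> pdy f p = 0"
    and "p \<in> D" "q \<in> D"
  shows "f p = f q"
  using assms(1,2) _ assms(6,7)
proof (rule has_derivative_zero_unique_connected)
  show "(f has_derivative (\<lambda>x. 0)) (at x)" if "x \<in> D" for x
    using C1_has_derivative[OF assms(1,3) that] assms(4,5) that by simp
qed

text \<open>Two applications of the mean value theorem: along \<open>s\<close> to the difference of
  \<open>f\<close> between the levels \<open>y + t\<close> and \<open>y\<close>, then along
  \<open>r\<close> to \<open>fx s\<close>.\<close>

lemma second_difference:
  fixes f fx fxy :: "real \<Rightarrow> real \<Rightarrow> real"
  assumes "t > 0"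
    and "\<And>s r. s \<in> {x..x+t} \<Longrightarrow> r \<in> {y..y+t} \<Longrightarrow> ((\<lambda>s. f s r) has_field_derivative fx s r) (at s)"
    and "\<And>s r. s \<in> {x..x+t} \<Longrightarrow> r \<in> {y..y+t} \<Longrightarrow> (fx s has_field_derivative fxy s r) (at r)"
  obtains s r where "s \<in> {x..x+t}" "r \<in> {y..y+t}"
    "f (x+t) (y+t) - f (x+t) y - f x (y+t) + f x y = t\<^sup>2 * fxy s r"
proof -
  obtain s where s: "x < s" "s < x + t"
    "(f (x+t) (y+t) - f (x+t) y) - (f x (y+t) - f x y) = (x + t - x) * (fx s (y+t) - fx s y)"
  proof -
    have "((\<lambda>s. f s (y+t) - f s y) has_field_derivative fx s (y+t) - fx s y) (at s)"
      if "x \<le> s" "s \<le> x + t" for s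
      using assms(1,2) that by (intro DERIV_diff) auto
    from MVT2[OF _ this, of x "x + t"] assms(1) that show thesis by auto
  qed
  obtain r where r: "y < r" "r < y + t" "fx s (y+t) - fx s y = (y + t - y) * fxy s r"
    using MVT2[of y "y+t" "fx s" "fxy s"] assms(1,3) s by auto
  show thesis
    using s r by (intro that[of s r]) (auto simp: power2_eq_square algebra_simps)
qed

text \<open>The second difference over a small square does not depend on the order of the variables,
  yet it equals \<open>t\<^sup>2\<close> times a value of either mixed derivative in that square.
  Continuity at \<open>p\<close> brings both values close to those at \<open>p\<close>.\<close>

lemma pdx_pdy_commute:
  assumes "open D" "Ck_on (Suc (Suc k)) D f" "p \<in> D"
  shows "pdx (pdy f) p = pdy (pdx f) p"
proof (rule ccontr)
  assume neq: "pdx (pdy f) p \<noteq> pdy (pdx f) p"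
  obtain x y where p: "p = (x, y)" by (cases p)
  \<comment> \<open>Half the assumed gap: two deviations smaller than \<open>e\<close> cannot bridge
    it.\<close>
  define e where "e = \<bar>pdx (pdy f) p - pdy (pdx f) p\<bar> / 2"
  have "e > 0" using neq by (simp add: e_def)
  have Cx: "Ck_on (Suc k) D (pdx f)" and Cy: "Ck_on (Suc k) D (pdy f)"
    using assms(2) by (simp_all only: Ck_on.simps(2)[of "Suc k"])
  have "continuous (at p) (pdx (pdy f))" "continuous (at p) (pdy (pdx f))"
    using Ck_on_continuous_partials(1)[OF Cy] Ck_on_continuous_partials(2)[OF Cx] assms(1,3)
    by (simp_all add: continuous_on_eq_continuous_at)
  then obtain d1 d2 where d: "d1 > 0" "d2 > 0"
    "\<And>q. dist q p < d1 \<Longrightarrow> dist (pdx (pdy f) q) (pdx (pdy f) p) < e"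
    "\<And>q. dist q p < d2 \<Longrightarrow> dist (pdy (pdx f) q) (pdy (pdx f) p) < e"
    using \<open>e > 0\<close> unfolding continuous_at_eps_delta by metis
  obtain d3 where d3: "d3 > 0" "ball p d3 \<subseteq> D" using assms(1,3) openE by blast
  \<comment> \<open>Points of the square of side \<open>t\<close> are at distance at most
    \<open>2 t\<close> from \<open>p\<close>, which is half of the smallest radius.\<close>
  define t where "t = min d1 (min d2 d3) / 4"
  have t: "t > 0" using d d3 by (simp add: t_def)
  have near: "dist (s, r) p < min d1 (min d2 d3)" if "s \<in> {x..x+t}" "r \<in> {y..y+t}" for s r
  proof -
    have "dist (s, r) p \<le> \<bar>s - x\<bar> + \<bar>r - y\<bar>"
      unfolding p dist_Pair_Pair by (rule order.trans[OF sqrt_sum_squares_le_sum_abs]) (simp add: dist_real_def)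
    then show ?thesis using that t unfolding t_def by auto
  qed
  then have inD: "(s, r) \<in> D" if "s \<in> {x..x+t}" "r \<in> {y..y+t}" for s r
    using that d3(2) by (metis dist_commute mem_ball min_less_iff_conj subsetD)
  obtain s r where sr: "s \<in> {x..x+t}" "r \<in> {y..y+t}"
    "f (x+t,y+t) - f (x+t,y) - f (x,y+t) + f (x,y) = t\<^sup>2 * pdy (pdx f) (s, r)"
    using second_difference[of t x y "\<lambda>s r. f (s, r)" "\<lambda>s r. pdx f (s, r)" "\<lambda>s r. pdy (pdx f) (s, r)"]
      Ck_on_has_partials(1)[OF assms(2)] Ck_on_has_partials(2)[OF Cx] inD t
    by (metis fst_conv snd_conv)
  \<comment> \<open>The same square with the roles of the two variables exchanged.\<close>
  obtain r' s' where sr': "s' \<in> {x..x+t}" "r' \<in> {y..y+t}"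
    "f (x+t,y+t) - f (x,y+t) - f (x+t,y) + f (x,y) = t\<^sup>2 * pdx (pdy f) (s', r')"
    using second_difference[of t y x "\<lambda>r s. f (s, r)" "\<lambda>r s. pdy f (s, r)" "\<lambda>r s. pdx (pdy f) (s, r)"]
      Ck_on_has_partials(2)[OF assms(2)] Ck_on_has_partials(1)[OF Cy] inD t
    by (metis fst_conv snd_conv)
  have "t\<^sup>2 * pdy (pdx f) (s, r) = t\<^sup>2 * pdx (pdy f) (s', r')"
    using sr(3) sr'(3) by linarith
  then have "pdy (pdx f) (s, r) = pdx (pdy f) (s', r')" using t by simp
  moreover have "\<bar>pdy (pdx f) (s, r) - pdy (pdx f) p\<bar> < e"
    "\<bar>pdx (pdy f) (s', r') - pdx (pdy f) p\<bar> < e"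
    using d(3,4) near[OF sr(1,2)] near[OF sr'(1,2)] by (auto simp: dist_real_def)
  ultimately have "\<bar>pdx (pdy f) p - pdy (pdx f) p\<bar> < e + e"
    by linarith
  then show False by (simp add: e_def)
qed

section \<open>Holomorphic functions from real Cauchy-Riemann pairs\<close>

lemma cauchy_riemann_has_field_derivative:
  assumes "(P has_derivative (\<lambda>h. fst h * a + snd h * (- b))) (at (Re z, Im z))"
    and "(Q has_derivative (\<lambda>h. fst h * b + snd h * a)) (at (Re z, Im z))"
  shows "((\<lambda>z. Complex (P (Re z, Im z)) (Q (Re z, Im z))) has_field_derivative Complex a b) (at z)"
proof -
  have R: "((\<lambda>z. (Re z, Im z)) has_derivative (\<lambda>h. (Re h, Im h))) (at z)"
    by (intro bounded_linear_imp_has_derivative bounded_linear_Pair bounded_linear_Re bounded_linear_Im)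
  have "((\<lambda>z. of_real (P (Re z, Im z)) + \<i> * of_real (Q (Re z, Im z))) has_derivative
     (\<lambda>h. of_real (Re h * a + Im h * (- b)) + \<i> * of_real (Re h * b + Im h * a))) (at z)"
    using has_derivative_compose[OF R assms(1)] has_derivative_compose[OF R assms(2)]
    by (intro derivative_intros) simp_all
  moreover have "(\<lambda>h. of_real (Re h * a + Im h * (- b)) + \<i> * of_real (Re h * b + Im h * a)) = (*) (Complex a b)"
    by (auto simp: fun_eq_iff complex_eq_iff algebra_simps)
  moreover have "(\<lambda>z. of_real (P (Re z, Im z)) + \<i> * of_real (Q (Re z, Im z))) =
      (\<lambda>z. Complex (P (Re z, Im z)) (Q (Re z, Im z)))"
    by (auto simp: fun_eq_iff complex_eq_iff)
  ultimately show ?thesis by (simp add: has_field_derivative_def)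
qed

lemma cauchy_riemann_holomorphic:
  assumes "open D" "Ck_on (Suc 0) D P" "Ck_on (Suc 0) D Q"
    and "\<And>p. p \<in> D \<Longrightarrow> pdx P p = pdy Q p" "\<And>p. p \<in> D \<Longrightarrow> pdy P p = - pdx Q p"
  shows "(\<lambda>z. Complex (P (Re z, Im z)) (Q (Re z, Im z))) holomorphic_on cdom D"
proof (rule holomorphic_onI)
  fix z assume "z \<in> cdom D"
  then have z: "(Re z, Im z) \<in> D" by (simp add: cdom_def)
  have "((\<lambda>z. Complex (P (Re z, Im z)) (Q (Re z, Im z))) has_field_derivative
      Complex (pdx P (Re z, Im z)) (pdx Q (Re z, Im z))) (at z)"
    using C1_has_derivative[OF assms(1,2) z] C1_has_derivative[OF assms(1,3) z] assms(4,5)[OF z]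
    by (intro cauchy_riemann_has_field_derivative) simp_all
  then show "(\<lambda>z. Complex (P (Re z, Im z)) (Q (Re z, Im z))) field_differentiable at z within cdom D"
    by (meson field_differentiable_at_within field_differentiable_def)
qed

section \<open>Goursat representation\<close>

text \<open>The usual Goursat formula takes the real part of \<open>cnj z * phi z + chi z\<close>.
  Since \<open>cnj z = z - 2 i y\<close>, it has this shape with \<open>a = z phi + chi\<close> and
  \<open>b = - 2 i phi\<close>. Using \<open>y\<close> in place of \<open>cnj z\<close> makes the
  comparison with the biharmonic algebra immediate.\<close>

definition goursat :: "(complex \<Rightarrow> complex) \<Rightarrow> (complex \<Rightarrow> complex) \<Rightarrow> real \<times> real \<Rightarrow> real" where
  "goursat a b p = Re (a (cpx p) + of_real (snd p) * b (cpx p))"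

definition goursat_on ::
  "(real \<times> real) set \<Rightarrow> (complex \<Rightarrow> complex) \<Rightarrow> (complex \<Rightarrow> complex) \<Rightarrow> (real \<times> real \<Rightarrow> real) \<Rightarrow> bool" where
  "goursat_on D a b W \<longleftrightarrow> a holomorphic_on cdom D \<and> b holomorphic_on cdom D \<and> (\<forall>p\<in>D. W p = goursat a b p)"

lemma goursat_has_derivative:
  assumes "(a has_field_derivative a') (at (cpx p))" "(b has_field_derivative b') (at (cpx p))"
  shows "(goursat a b has_derivative (\<lambda>h. fst h * Re (a' + of_real (snd p) * b') +
     snd h * Re (\<i> * a' + b (cpx p) + of_real (snd p) * (\<i> * b')))) (at p)"
proof -
  have c: "(cpx has_derivative cpx) (at p)"
    by (rule bounded_linear_imp_has_derivative[OF bounded_linear_cpx])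
  have a: "((\<lambda>q. a (cpx q)) has_derivative (\<lambda>h. a' * cpx h)) (at p)"
    using has_derivative_compose[OF c, of a "\<lambda>h. a' * h"] assms(1) by (simp add: has_field_derivative_def)
  have b: "((\<lambda>q. b (cpx q)) has_derivative (\<lambda>h. b' * cpx h)) (at p)"
    using has_derivative_compose[OF c, of b "\<lambda>h. b' * h"] assms(2) by (simp add: has_field_derivative_def)
  have "(goursat a b has_derivative
    (\<lambda>h. Re (a' * cpx h + (of_real (snd p) * (b' * cpx h) + of_real (snd h) * b (cpx p))))) (at p)"
    unfolding goursat_def[abs_def]
    by (intro has_derivative_Re has_derivative_add a has_derivative_mult b has_derivative_of_real has_derivative_snd
        has_derivative_ident)
  moreover have "(\<lambda>h. Re (a' * cpx h + (of_real (snd p) * (b' * cpx h) + of_real (snd h) * b (cpx p)))) =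
     (\<lambda>h. fst h * Re (a' + of_real (snd p) * b') +
     snd h * Re (\<i> * a' + b (cpx p) + of_real (snd p) * (\<i> * b')))"
    by (auto simp: fun_eq_iff algebra_simps)
  ultimately show ?thesis by simp
qed

lemma goursat_on_cong:
  assumes "goursat_on D a b W" "\<And>z. z \<in> cdom D \<Longrightarrow> a z = a' z" "\<And>z. z \<in> cdom D \<Longrightarrow> b z = b' z"
    "\<And>p. p \<in> D \<Longrightarrow> W p = W' p"
  shows "goursat_on D a' b' W'"
  using assms unfolding goursat_on_def goursat_def
  by (auto cong: holomorphic_cong)

text \<open>The representation is stable under differentiation: \<open>pdx\<close> acts as the
  complex derivative on both coefficients, and \<open>pdy\<close> as \<open>i\<close> times it, the
  factor \<open>y\<close> contributing the additional summand \<open>b\<close>.\<close>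

lemma goursat_on_partials:
  assumes "open D" "goursat_on D a b W"
  shows "goursat_on D (deriv a) (deriv b) (pdx W)"
    "goursat_on D (\<lambda>z. \<i> * deriv a z + b z) (\<lambda>z. \<i> * deriv b z) (pdy W)"
    "p \<in> D \<Longrightarrow> (\<lambda>t. W (t, snd p)) field_differentiable at (fst p)"
    "p \<in> D \<Longrightarrow> (\<lambda>t. W (fst p, t)) field_differentiable at (snd p)"
    "continuous_on D W"
proof -
  note o = open_cdom[OF assms(1)]
  have hol: "a holomorphic_on cdom D" "b holomorphic_on cdom D"
    and W: "\<And>p. p \<in> D \<Longrightarrow> W p = goursat a b p"
    using assms(2) by (auto simp: goursat_on_def)
  have tot: "(W has_derivative (\<lambda>h. fst h * goursat (deriv a) (deriv b) p +
     snd h * goursat (\<lambda>z. \<i> * deriv a z + b z) (\<lambda>z. \<i> * deriv b z) p)) (at p)" if "p \<in> D" for p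
  proof -
    have "(a has_field_derivative deriv a (cpx p)) (at (cpx p))"
      "(b has_field_derivative deriv b (cpx p)) (at (cpx p))"
      using hol that by (auto intro!: holomorphic_derivI[OF _ o])
    from goursat_has_derivative[OF this] have
      "(goursat a b has_derivative (\<lambda>h. fst h * goursat (deriv a) (deriv b) p +
     snd h * goursat (\<lambda>z. \<i> * deriv a z + b z) (\<lambda>z. \<i> * deriv b z) p)) (at p)"
      unfolding goursat_def by simp
    then show ?thesis
      by (rule has_derivative_transform_within_open[OF _ assms(1) that]) (simp add: W)
  qed
  show "goursat_on D (deriv a) (deriv b) (pdx W)"
    "goursat_on D (\<lambda>z. \<i> * deriv a z + b z) (\<lambda>z. \<i> * deriv b z) (pdy W)"
    using pdx_pdy_of_total[OF tot]
    by (auto simp: goursat_on_def intro!: holomorphic_intros hol o)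
  show "(\<lambda>t. W (t, snd p)) field_differentiable at (fst p)"
    "(\<lambda>t. W (fst p, t)) field_differentiable at (snd p)" if "p \<in> D"
    using partials_of_total[OF tot[OF that]] by (auto simp: field_differentiable_def)
  show "continuous_on D W"
    using tot by (meson continuous_at_imp_continuous_on has_derivative_continuous)
qed

text \<open>Partial derivatives stay in the class, so smoothness of every order follows by induction
  from continuity and differentiability alone.\<close>

lemma goursat_on_Ck_on:
  assumes "open D" "goursat_on D a b W"
  shows "Ck_on k D W"
  using assms(2)
proof (induction k arbitrary: a b W)
  case 0
  then show ?case using goursat_on_partials(5)[OF assms(1)] by simp
next
  case (Suc k)
  note p = goursat_on_partials[OF assms(1) Suc.prems]
  from Suc.IH[OF p(1)] Suc.IH[OF p(2)] p(3-5) show ?case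
    unfolding Ck_on.simps(2) by blast
qed

lemma deriv_add_mult_on:
  assumes "open S" "f holomorphic_on S" "g holomorphic_on S" "z \<in> S"
  shows "deriv (\<lambda>z. c * f z + d * g z) z = c * deriv f z + d * deriv g z"
  using holomorphic_derivI[OF assms(2,1,4)] holomorphic_derivI[OF assms(3,1,4)]
  by (intro DERIV_imp_deriv) (auto intro!: derivative_eq_intros)

text \<open>In the Laplacian the terms with \<open>a2\<close> and with \<open>y\<close> cancel and
  \<open>Re (2 i b')\<close> remains; thus \<open>b\<close> alone measures how far \<open>W\<close>
  is from being harmonic.\<close>

lemma goursat_on_second_partials:
  assumes "open D" "goursat_on D a b W"
  defines "a2 \<equiv> deriv (deriv a)" and "b2 \<equiv> deriv (deriv b)"
  shows "goursat_on D a2 b2 (pdx (pdx W))"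
    "goursat_on D (\<lambda>z. \<i> * a2 z + deriv b z) (\<lambda>z. \<i> * b2 z) (pdx (pdy W))"
    "goursat_on D (\<lambda>z. \<i> * a2 z + deriv b z) (\<lambda>z. \<i> * b2 z) (pdy (pdx W))"
    "goursat_on D (\<lambda>z. - a2 z + 2 * \<i> * deriv b z) (\<lambda>z. - b2 z) (pdy (pdy W))"
    "goursat_on D (\<lambda>z. 2 * \<i> * deriv b z) (\<lambda>z. 0) (laplace W)"
proof -
  note o = open_cdom[OF assms(1)]
  note gx = goursat_on_partials(1)[OF assms(1)] and gy = goursat_on_partials(2)[OF assms(1)]
  have hol: "a holomorphic_on cdom D" "b holomorphic_on cdom D"
    using assms(2) by (auto simp: goursat_on_def)
  have hol': "deriv a holomorphic_on cdom D" "deriv b holomorphic_on cdom D"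
    using hol o by (auto intro: holomorphic_deriv)
  have d: "deriv (\<lambda>z. \<i> * deriv a z + b z) z = \<i> * a2 z + deriv b z"
    "deriv (\<lambda>z. \<i> * deriv b z) z = \<i> * b2 z" if "z \<in> cdom D" for z
    using deriv_add_mult_on[OF o hol'(1) hol(2) that, of \<i> 1]
      deriv_add_mult_on[OF o hol'(2) hol(2) that, of \<i> 0]
    by (simp_all add: a2_def b2_def)
  show xx: "goursat_on D a2 b2 (pdx (pdx W))"
    unfolding a2_def b2_def by (rule gx[OF gx[OF assms(2)]])
  show "goursat_on D (\<lambda>z. \<i> * a2 z + deriv b z) (\<lambda>z. \<i> * b2 z) (pdx (pdy W))"
    by (rule goursat_on_cong[OF gx[OF gy[OF assms(2)]]]) (simp_all add: d)
  show "goursat_on D (\<lambda>z. \<i> * a2 z + deriv b z) (\<lambda>z. \<i> * b2 z) (pdy (pdx W))"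
    unfolding a2_def b2_def by (rule gy[OF gx[OF assms(2)]])
  show yy: "goursat_on D (\<lambda>z. - a2 z + 2 * \<i> * deriv b z) (\<lambda>z. - b2 z) (pdy (pdy W))"
    by (rule goursat_on_cong[OF gy[OF gy[OF assms(2)]]]) (simp_all add: d distrib_left)
  show "goursat_on D (\<lambda>z. 2 * \<i> * deriv b z) (\<lambda>z. 0) (laplace W)"
    using xx yy hol' by (auto simp: goursat_on_def goursat_def laplace_def intro!: holomorphic_intros)
qed

text \<open>The Laplacian is again of Goursat form, now with second coefficient zero, so applying
  the Laplacian once more gives zero.\<close>

lemma goursat_on_biharmonic:
  assumes "open D" "goursat_on D a b W"
  shows "biharmonic_on D W"
proof -
  have "goursat_on D (\<lambda>z. 2 * \<i> * deriv b z) (\<lambda>z. 0) (laplace W)"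
    by (rule goursat_on_second_partials(5)[OF assms])
  from goursat_on_second_partials(5)[OF assms(1) this] goursat_on_Ck_on[OF assms] show ?thesis
    by (simp add: biharmonic_on_def goursat_on_def goursat_def)
qed

section \<open>Linearity of the derivatives, and existence of Goursat representations\<close>

lemma pdx_pdy_linear:
  assumes "Ck_on (Suc k) D f" "Ck_on (Suc k) D g" "p \<in> D"
  shows "pdx (\<lambda>p. c * f p + d * g p) p = c * pdx f p + d * pdx g p"
    "pdy (\<lambda>p. c * f p + d * g p) p = c * pdy f p + d * pdy g p"
  unfolding pdx_def[of "\<lambda>p. c * f p + d * g p"] pdy_def[of "\<lambda>p. c * f p + d * g p"]
  using Ck_on_has_partials[OF assms(1,3)] Ck_on_has_partials[OF assms(2,3)]
  by (auto intro!: DERIV_imp_deriv derivative_eq_intros)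

text \<open>One form covers sums, differences and multiples. Later definitions carry factors such as
  \<open>1\<close>, \<open>(- 1)\<close> or a dummy term with factor \<open>0\<close> in order to be
  literal instances of it.\<close>

lemma Ck_on_linear:
  assumes "open D" "Ck_on k D f" "Ck_on k D g"
  shows "Ck_on k D (\<lambda>p. c * f p + d * g p)"
  using assms(2,3)
proof (induction k arbitrary: f g)
  case 0
  then show ?case by (auto intro!: continuous_intros)
next
  case (Suc k)
  have "Ck_on k D (\<lambda>p. c * pdx f p + d * pdx g p)" "Ck_on k D (\<lambda>p. c * pdy f p + d * pdy g p)"
    using Suc by auto
  then have "Ck_on k D (pdx (\<lambda>p. c * f p + d * g p))" "Ck_on k D (pdy (\<lambda>p. c * f p + d * g p))"
    using pdx_pdy_linear[OF Suc.prems] by (simp_all cong: Ck_on_cong[OF assms(1)])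
  moreover have "(\<lambda>t. c * f (t, snd p) + d * g (t, snd p)) field_differentiable at (fst p)"
    "(\<lambda>t. c * f (fst p, t) + d * g (fst p, t)) field_differentiable at (snd p)" if "p \<in> D" for p
    using Suc.prems that by (auto intro!: derivative_intros)
  moreover have "continuous_on D (\<lambda>p. c * f p + d * g p)"
    using Suc.prems by (auto intro!: continuous_intros)
  ultimately show ?case unfolding Ck_on.simps(2) by blast
qed

lemma Ck_on_second_partials:
  assumes "Ck_on (Suc (Suc k)) D W"
  shows "Ck_on (Suc k) D (pdx W)" "Ck_on (Suc k) D (pdy W)"
    "Ck_on k D (pdx (pdx W))" "Ck_on k D (pdy (pdy W))"
  using assms by (auto simp only: Ck_on.simps(2))

lemma laplace_linear:
  assumes "open D" "Ck_on (Suc (Suc k)) D f" "Ck_on (Suc (Suc k)) D g" "p \<in> D"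
  shows "laplace (\<lambda>p. c * f p + d * g p) p = c * laplace f p + d * laplace g p"
proof -
  have "pdx (pdx (\<lambda>p. c * f p + d * g p)) p = pdx (\<lambda>p. c * pdx f p + d * pdx g p) p"
    "pdy (pdy (\<lambda>p. c * f p + d * g p)) p = pdy (\<lambda>p. c * pdy f p + d * pdy g p) p"
    using pdx_pdy_linear[OF assms(2,3)]
    by (intro pdx_pdy_cong[OF assms(1,4)]; simp)+
  then show ?thesis
    using pdx_pdy_linear(1)[OF Ck_on_second_partials(1)[OF assms(2)] Ck_on_second_partials(1)[OF assms(3)] assms(4)]
      pdx_pdy_linear(2)[OF Ck_on_second_partials(2)[OF assms(2)] Ck_on_second_partials(2)[OF assms(3)] assms(4)]
    by (simp add: laplace_def algebra_simps)
qed

text \<open>\<open>W_x - i W_y\<close> is holomorphic: its Cauchy-Riemann equations are harmonicity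
  and symmetry of the mixed derivatives. The real part of a primitive has the gradient of
  \<open>W\<close>, and the constant by which the two differ is absorbed into
  \<open>a\<close>.\<close>

lemma harmonic_imp_goursat:
  assumes "open D" "simply_connected D" "Ck_on (Suc (Suc 0)) D W" "\<And>p. p \<in> D \<Longrightarrow> laplace W p = 0"
  obtains a where "goursat_on D a (\<lambda>_. 0) W"
proof (cases "D = {}")
  case True
  then show thesis by (intro that[of "\<lambda>_. 0"]) (auto simp: goursat_on_def)
next
  case False
  then obtain q where q: "q \<in> D" by blast
  note C = Ck_on_second_partials[OF assms(3)]
  define Q where "Q = (\<lambda>p. (- 1) * pdy W p + 0 * pdy W p)"
  have Q: "Ck_on (Suc 0) D Q"
    unfolding Q_def by (rule Ck_on_linear[OF assms(1) C(2,2)])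
  have Qp: "pdx Q p = - pdx (pdy W) p" "pdy Q p = - pdy (pdy W) p" if "p \<in> D" for p
    unfolding Q_def using pdx_pdy_linear[OF C(2,2) that, of "-1" 0] by simp_all
  have "(\<lambda>z. Complex (pdx W (Re z, Im z)) (Q (Re z, Im z))) holomorphic_on cdom D"
    by (rule cauchy_riemann_holomorphic[OF assms(1) C(1) Q])
      (use Qp pdx_pdy_commute[OF assms(1,3)] assms(4) in \<open>auto simp: laplace_def add_eq_0_iff\<close>)
  then obtain A where A: "A holomorphic_on cdom D"
    "\<And>z. z \<in> cdom D \<Longrightarrow> deriv A z = Complex (pdx W (Re z, Im z)) (Q (Re z, Im z))"
    using primitive_on_cdom[OF assms(1,2)] by blast
  let ?G = "goursat A (\<lambda>_. 0)"
  have G: "goursat_on D A (\<lambda>_. 0) ?G"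
    using A(1) by (simp add: goursat_on_def)
  have Gp: "pdx ?G p = pdx W p" "pdy ?G p = pdy W p" if "p \<in> D" for p
    using goursat_on_partials(1,2)[OF assms(1) G] that A(2)[of "cpx p"]
    by (auto simp: goursat_on_def goursat_def Q_def)
  have CW: "Ck_on (Suc 0) D W" using Ck_on_SucD[OF assms(3)] .
  have CG: "Ck_on (Suc 0) D ?G" using goursat_on_Ck_on[OF assms(1) G] .
  define V where "V = (\<lambda>p. 1 * W p + (- 1) * ?G p)"
  have CV: "Ck_on (Suc 0) D V"
    unfolding V_def by (rule Ck_on_linear[OF assms(1) CW CG])
  have Vp: "pdx V p = 0" "pdy V p = 0" if "p \<in> D" for p
    unfolding V_def using pdx_pdy_linear[OF CW CG that, of 1 "-1"] Gp[OF that] by simp_all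
  have V: "V p = V q" if "p \<in> D" for p
    using C1_zero_gradient_constant[OF assms(1) simply_connected_imp_connected[OF assms(2)] CV Vp that q] .
  have "W p = goursat (\<lambda>z. A z + of_real (V q)) (\<lambda>_. 0) p" if "p \<in> D" for p
    using V[OF that] by (simp add: goursat_def V_def algebra_simps)
  then have "goursat_on D (\<lambda>z. A z + of_real (V q)) (\<lambda>_. 0) W"
    using A(1) by (auto intro!: holomorphic_intros simp: goursat_on_def)
  then show thesis by (rule that)
qed

text \<open>The Laplacian is harmonic, hence the real part of some holomorphic \<open>f\<close>.
  Solving \<open>2 i b' = f\<close> gives \<open>Re (y b)\<close> the same Laplacian as
  \<open>W\<close>, so the harmonic case applies to the difference.\<close>

lemma biharmonic_imp_goursat:
  assumes "open D" "simply_connected D" "biharmonic_on D W"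
  obtains a b where "goursat_on D a b W"
proof -
  have C4: "Ck_on (Suc (Suc (Suc (Suc 0)))) D W" and bi: "\<And>p. p \<in> D \<Longrightarrow> laplace (laplace W) p = 0"
    using assms(3) by (auto simp: biharmonic_on_def numeral_eq_Suc)
  have "Ck_on (Suc (Suc 0)) D (\<lambda>p. 1 * pdx (pdx W) p + 1 * pdy (pdy W) p)"
    using Ck_on_second_partials[OF C4] by (intro Ck_on_linear[OF assms(1)])
  then have CL: "Ck_on (Suc (Suc 0)) D (laplace W)"
    by (simp add: laplace_def[abs_def])
  from harmonic_imp_goursat[OF assms(1,2) CL bi] obtain f where f: "goursat_on D f (\<lambda>_. 0) (laplace W)" .
  then have "(\<lambda>z. - \<i> * f z / 2) holomorphic_on cdom D"
    by (auto simp: goursat_on_def intro!: holomorphic_intros)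
  then obtain b where b: "b holomorphic_on cdom D" "\<And>z. z \<in> cdom D \<Longrightarrow> deriv b z = - \<i> * f z / 2"
    using primitive_on_cdom[OF assms(1,2)] by blast
  let ?G = "goursat (\<lambda>_. 0) b"
  have G: "goursat_on D (\<lambda>_. 0) b ?G"
    using b(1) by (simp add: goursat_on_def)
  note CG = goursat_on_Ck_on[OF assms(1) G]
  have LG: "laplace ?G p = laplace W p" if "p \<in> D" for p
    using goursat_on_second_partials(5)[OF assms(1) G] f that b(2)[of "cpx p"]
    by (auto simp: goursat_on_def goursat_def)
  define V where "V = (\<lambda>p. 1 * W p + (- 1) * ?G p)"
  have "Ck_on (Suc (Suc 0)) D V"
    unfolding V_def by (intro Ck_on_linear[OF assms(1)] CG Ck_on_SucD[OF Ck_on_SucD[OF C4]])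
  moreover have "laplace V p = 0" if "p \<in> D" for p
    unfolding V_def using laplace_linear[OF assms(1) C4 CG that, of 1 "-1"] LG[OF that] by simp
  ultimately obtain a where "goursat_on D a (\<lambda>_. 0) V"
    using harmonic_imp_goursat[OF assms(1,2)] by blast
  then have "goursat_on D a b W"
    using b(1) by (auto simp: goursat_on_def goursat_def V_def)
  then show thesis by (rule that)
qed

section \<open>Uniqueness\<close>

text \<open>If the real part were positive at \<open>q\<close>, its superlevel set at the value
  there would be compact, so a maximum would be attained inside \<open>D\<close>. Then the real part
  is a positive constant, contrary to its boundary limits.\<close>

lemma Re_le_0_of_boundary:
  assumes "open D" "connected D" "D \<noteq> {}" "bounded D" "F holomorphic_on cdom D"
    and lim: "\<And>p. p \<in> frontier D \<Longrightarrow> ((\<lambda>p. Re (F (cpx p))) \<longlongrightarrow> 0) (at p within D)"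
    and q: "q \<in> D"
  shows "Re (F (cpx q)) \<le> 0"
proof (rule ccontr)
  let ?r = "\<lambda>p. Re (F (cpx p))"
  assume neg: "\<not> ?thesis"
  define c where "c = ?r q"
  have c: "c > 0" using neg by (simp add: c_def)
  have "continuous_on D (\<lambda>p. F (cpx p))"
    by (rule continuous_on_compose2[OF holomorphic_on_imp_continuous_on[OF assms(5)]
          continuous_on_cpx[OF continuous_on_id]]) auto
  then have cont: "continuous_on D ?r" by (rule continuous_on_Re)
  define K where "K = {p \<in> D. c \<le> ?r p}"
  \<comment> \<open>A limit point of \<open>K\<close> cannot lie on the frontier: the limit there is
    zero, whereas all values on \<open>K\<close> are at least \<open>c > 0\<close>.\<close>
  have "closed K"
    unfolding closed_limpt
  proof (intro allI impI)
    fix x assume x: "x islimpt K"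
    have "x \<in> closure D"
      using x by (auto simp: K_def closure_def intro: islimpt_subset)
    then have lim_x: "(?r \<longlongrightarrow> (if x \<in> D then ?r x else 0)) (at x within D)"
      using cont lim[of x] assms(1) by (auto simp: continuous_on_def frontier_def interior_open)
    have "(?r \<longlongrightarrow> (if x \<in> D then ?r x else 0)) (at x within K)"
      by (rule tendsto_within_subset[OF lim_x]) (auto simp: K_def)
    moreover have "eventually (\<lambda>p. c \<le> ?r p) (at x within K)"
      by (auto simp: K_def eventually_at_filter)
    moreover have "at x within K \<noteq> bot"
      using x by (simp add: trivial_limit_within)
    ultimately have "c \<le> (if x \<in> D then ?r x else 0)"
      by (rule tendsto_lowerbound)
    then show "x \<in> K" using c by (auto simp: K_def split: if_splits)
  qed
  moreover have "bounded K"
    using assms(4) by (rule bounded_subset) (auto simp: K_def)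
  ultimately have "compact K" by (simp add: compact_eq_bounded_closed)
  moreover have "K \<noteq> {}" using q unfolding K_def c_def by blast
  moreover have "continuous_on K ?r" using cont by (rule continuous_on_subset) (auto simp: K_def)
  ultimately obtain m where m: "m \<in> K" "\<And>p. p \<in> K \<Longrightarrow> ?r p \<le> ?r m"
    using continuous_attains_sup by metis
  have mD: "m \<in> D" "c \<le> ?r m" using m(1) by (auto simp: K_def)
  have max: "?r p \<le> ?r m" if "p \<in> D" for p
    using m(2)[of p] mD(2) that by (cases "p \<in> K") (auto simp: K_def)
  \<comment> \<open>The modulus of \<open>exp (F z)\<close> is the exponential of the real part, so
    the maximum modulus principle speaks about \<open>Re F\<close>.\<close>
  have "(\<lambda>z. exp (F z)) constant_on cdom D"
  proof (rule maximum_modulus_principle[OF _ _ _ _ subset_refl])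
    show "norm (exp (F z)) \<le> norm (exp (F (cpx m)))" if "z \<in> cdom D" for z
      using that max by (elim cdomE) simp
  qed (use assms mD in \<open>auto intro!: holomorphic_intros open_cdom connected_cdom\<close>)
  then obtain w where "\<forall>z\<in>cdom D. exp (F z) = w" by (auto simp: constant_on_def)
  then have "exp (F (cpx p)) = exp (F (cpx m))" if "p \<in> D" for p
    using that mD(1) by simp
  then have const: "?r p = ?r m" if "p \<in> D" for p
    using that by (metis exp_inj_iff norm_exp_eq_Re)
  \<comment> \<open>Boundedness provides a frontier point, at which the constant positive value
    meets the limit zero.\<close>
  have "D \<noteq> UNIV" using assms(4) not_bounded_UNIV by blast
  then obtain x where x: "x \<in> frontier D"
    using assms(3) frontier_eq_empty by blast
  have "x islimpt D"
    using x assms(1) by (auto simp: frontier_def interior_open closure_def)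
  then have "at x within D \<noteq> bot" by (simp add: trivial_limit_within)
  moreover have "(?r \<longlongrightarrow> ?r m) (at x within D)"
    using const by (intro tendsto_eventually) (auto simp: eventually_at_filter)
  ultimately have "?r m = 0" using lim[OF x] tendsto_unique by blast
  then show False using mD c by simp
qed

lemma Re_eq_0_of_boundary:
  assumes "open D" "connected D" "D \<noteq> {}" "bounded D" "F holomorphic_on cdom D"
    and "\<And>p. p \<in> frontier D \<Longrightarrow> ((\<lambda>p. Re (F (cpx p))) \<longlongrightarrow> 0) (at p within D)"
    and "q \<in> D"
  shows "Re (F (cpx q)) = 0"
proof (rule antisym)
  show "Re (F (cpx q)) \<le> 0" by (rule Re_le_0_of_boundary[OF assms])
  have "Re (- F (cpx q)) \<le> 0"
    by (rule Re_le_0_of_boundary[OF assms(1-4) _ _ assms(7)])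
      (use assms(5,6) in \<open>auto intro!: holomorphic_intros tendsto_minus[where a = "0::real", simplified]\<close>)
  then show "0 \<le> Re (F (cpx q))" by simp
qed

text \<open>The pair \<open>F\<close>, \<open>0\<close> represents the zero function; its two
  partial derivatives are the real part and minus the imaginary part of the derivative of
  \<open>F\<close>.\<close>

lemma deriv_eq_0_of_Re_eq_0:
  assumes "open D" "F holomorphic_on cdom D" "\<And>p. p \<in> D \<Longrightarrow> Re (F (cpx p)) = 0" "p \<in> D"
  shows "deriv F (cpx p) = 0"
proof -
  have "goursat_on D F (\<lambda>_. 0) (\<lambda>_. 0)"
    using assms(2,3) by (auto simp: goursat_on_def goursat_def)
  note g = goursat_on_partials(1,2)[OF assms(1) this]
  have "pdx (\<lambda>_. 0) p = 0" "pdy (\<lambda>_. 0) p = 0" by (simp_all add: pdx_def pdy_def)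
  with g assms(4) show ?thesis by (auto simp: goursat_on_def goursat_def complex_eq_iff)
qed

text \<open>The difference of the \<open>W_xx\<close> need not be harmonic a priori, because of the
  terms with the factor \<open>y\<close>. The difference of the Laplacians is, so it is treated
  before.\<close>

lemma biharmonic_second_partials_unique:
  assumes "open D" "simply_connected D" "D \<noteq> {}" "bounded D" "biharmonic_on D W" "biharmonic_on D W'"
    and x: "\<And>p. p \<in> frontier D \<Longrightarrow> ((\<lambda>p. pdx (pdx W) p - pdx (pdx W') p) \<longlongrightarrow> 0) (at p within D)"
    and y: "\<And>p. p \<in> frontier D \<Longrightarrow> ((\<lambda>p. pdy (pdy W) p - pdy (pdy W') p) \<longlongrightarrow> 0) (at p within D)"
    and "q \<in> D"
  shows "pdx (pdx W) q = pdx (pdx W') q" "pdy (pdy W) q = pdy (pdy W') q"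
proof -
  note o = open_cdom[OF assms(1)]
  have conn: "connected D" using assms(2) simply_connected_imp_connected by blast
  obtain a b where W: "goursat_on D a b W" using biharmonic_imp_goursat[OF assms(1,2,5)] .
  obtain a' b' where W': "goursat_on D a' b' W'" using biharmonic_imp_goursat[OF assms(1,2,6)] .
  have hol: "a holomorphic_on cdom D" "b holomorphic_on cdom D" "a' holomorphic_on cdom D" "b' holomorphic_on cdom D"
    using W W' by (auto simp: goursat_on_def)
  note hol' = hol[THEN holomorphic_deriv, OF o] hol[THEN holomorphic_deriv, OF o, THEN holomorphic_deriv, OF o]
  note s = goursat_on_second_partials[OF assms(1) W] and s' = goursat_on_second_partials[OF assms(1) W']
  define F where "F z = 2 * \<i> * deriv b z + (- 2 * \<i>) * deriv b' z" for z
  have F: "F holomorphic_on cdom D"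
    unfolding F_def[abs_def] by (intro holomorphic_intros hol')
  have LF: "laplace W p - laplace W' p = Re (F (cpx p))" if "p \<in> D" for p
    using s(5) s'(5) that by (auto simp: goursat_on_def goursat_def F_def algebra_simps)
  have F0: "Re (F (cpx p)) = 0" if "p \<in> D" for p
  proof (rule Re_eq_0_of_boundary[OF assms(1) conn assms(3,4) F _ that])
    fix p assume p: "p \<in> frontier D"
    have "((\<lambda>p. laplace W p - laplace W' p) \<longlongrightarrow> 0) (at p within D)"
      using tendsto_add[OF x[OF p] y[OF p]] by (simp add: laplace_def algebra_simps)
    moreover have "eventually (\<lambda>p. laplace W p - laplace W' p = Re (F (cpx p))) (at p within D)"
      by (auto simp: eventually_at_filter LF)
    ultimately show "((\<lambda>p. Re (F (cpx p))) \<longlongrightarrow> 0) (at p within D)"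
      using tendsto_cong by fast
  qed
  \<comment> \<open>A holomorphic function with vanishing real part has derivative zero. This
    removes the \<open>y\<close> terms from the difference of the \<open>W_xx\<close>, which becomes
    the real part of the holomorphic \<open>A\<close> below.\<close>
  have b2: "deriv (deriv b) (cpx p) = deriv (deriv b') (cpx p)" if "p \<in> D" for p
    using deriv_eq_0_of_Re_eq_0[OF assms(1) F F0 that] that
      deriv_add_mult_on[OF o hol'(2,4), of "cpx p" "2 * \<i>" "- 2 * \<i>"]
    by (simp add: F_def[abs_def])
  define A where "A z = deriv (deriv a) z - deriv (deriv a') z" for z
  have A: "A holomorphic_on cdom D"
    unfolding A_def[abs_def] by (intro holomorphic_intros hol')
  have xA: "pdx (pdx W) p - pdx (pdx W') p = Re (A (cpx p))" if "p \<in> D" for p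
    using s(1) s'(1) that b2[OF that] by (auto simp: goursat_on_def goursat_def A_def)
  have "Re (A (cpx q)) = 0"
  proof (rule Re_eq_0_of_boundary[OF assms(1) conn assms(3,4) A _ assms(9)])
    fix p assume p: "p \<in> frontier D"
    have "eventually (\<lambda>p. pdx (pdx W) p - pdx (pdx W') p = Re (A (cpx p))) (at p within D)"
      by (auto simp: eventually_at_filter xA)
    then show "((\<lambda>p. Re (A (cpx p))) \<longlongrightarrow> 0) (at p within D)"
      using x[OF p] tendsto_cong by fast
  qed
  then show "pdx (pdx W) q = pdx (pdx W') q" using xA[OF assms(9)] by simp
  then show "pdy (pdy W) q = pdy (pdy W') q"
    using LF[OF assms(9)] F0[OF assms(9)] by (simp add: laplace_def)
qed

lemma goursat_on_partial_values:
  assumes "open D" "goursat_on D a b W" "p \<in> D"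
    and "(a has_field_derivative a') (at (cpx p))" "(b has_field_derivative b') (at (cpx p))"
  shows "pdx W p = Re (a' + of_real (snd p) * b')"
    "pdy W p = Re (\<i> * a' + b (cpx p) + of_real (snd p) * (\<i> * b'))"
  using goursat_on_partials(1,2)[OF assms(1,2)] assms(3) DERIV_imp_deriv[OF assms(4)] DERIV_imp_deriv[OF assms(5)]
  by (auto simp: goursat_on_def goursat_def)

section \<open>Displacements and the Airy stress function\<close>

text \<open>The solution of \<open>1 + 2 c = 1 / (1 + gamma) = mu / (lam + 2 mu)\<close>, which
  makes the real part of \<open>c f + (1 + c) cnj f\<close> equal to the dilatation; the imaginary
  part is minus the rotation for any \<open>c\<close>. Equivalently,
  \<open>c = - 1 / (4 kappa0)\<close>.\<close>

definition lame_c :: "real \<Rightarrow> real \<Rightarrow> real" where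
  "lame_c lam \<mu> = - (lam + \<mu>) / (2 * (lam + 2 * \<mu>))"

text \<open>The first identity links \<open>c\<close> to the constant of the stress formulas, the
  second to the Lame system.\<close>

lemma lame_c:
  assumes "\<mu> > 0" "lam + \<mu> > 0"
  shows "4 * kappa0 lam \<mu> * lame_c lam \<mu> = - 1"
    "(1 + 2 * lame_c lam \<mu>) * (1 + (lam + \<mu>) / \<mu>) = 1"
proof -
  define r where "r = lam + 2 * \<mu>"
  define s where "s = lam + \<mu>"
  have pos: "r > 0" "s > 0" and r: "r = s + \<mu>" using assms by (auto simp: s_def r_def)
  have "kappa0 lam \<mu> = r / (2 * s)" and c: "lame_c lam \<mu> = - s / (2 * r)"
    by (simp_all add: kappa0_def lame_c_def r_def s_def)
  then show "4 * kappa0 lam \<mu> * lame_c lam \<mu> = - 1" using pos by simp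
  have "1 + 2 * lame_c lam \<mu> = \<mu> / r" "1 + (lam + \<mu>) / \<mu> = r / \<mu>"
    using pos assms(1) unfolding c s_def[symmetric] by (simp_all add: r field_simps)
  then show "(1 + 2 * lame_c lam \<mu>) * (1 + (lam + \<mu>) / \<mu>) = 1" using pos assms(1) by simp
qed

text \<open>
  The Lame system makes \<open>f = (1 + \<gamma>) \<theta> + \<i> \<omega>\<close> with \<open>\<omega> = v\<^sub>x - u\<^sub>y\<close> holomorphic, and
  \<open>(\<partial>\<^sub>x + \<i> \<partial>\<^sub>y) (u - \<i> v) = \<theta> - \<i> \<omega> = c f + (1 + c) cnj f\<close> for \<open>c = lame_c lam \<mu>\<close>. If \<open>h' = f\<close>, this
  integrates to \<open>u - \<i> v = - \<i> c y h' + (1 + c) / 2 cnj h + k\<close> with \<open>k\<close> holomorphic.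
\<close>

definition kolosov :: "real \<Rightarrow> (real \<times> real) set \<Rightarrow> (complex \<Rightarrow> complex) \<Rightarrow> (complex \<Rightarrow> complex) \<Rightarrow>
    (real \<times> real \<Rightarrow> real) \<Rightarrow> (real \<times> real \<Rightarrow> real) \<Rightarrow> bool" where
  "kolosov c D h k u v \<longleftrightarrow> h holomorphic_on cdom D \<and> k holomorphic_on cdom D \<and>
    goursat_on D (\<lambda>z. of_real ((1 + c) / 2) * h z + k z) (\<lambda>z. - \<i> * of_real c * deriv h z) u \<and>
    goursat_on D (\<lambda>z. - \<i> * of_real ((1 + c) / 2) * h z + \<i> * k z) (\<lambda>z. of_real c * deriv h z) v"

text \<open>In \<open>u_x + v_y\<close> and in \<open>v_x - u_y\<close> the terms with
  \<open>k\<close> and with \<open>snd p\<close> cancel, leaving \<open>(1 + 2 c) Re h'\<close> and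
  \<open>Im h'\<close>: the dilatation and the rotation depend on \<open>h\<close> only.\<close>

lemma kolosov_first_partials:
  assumes "open D" "kolosov c D h k u v" "p \<in> D"
  defines "z \<equiv> cpx p"
  shows "pdx u p = (1 + c) / 2 * Re (deriv h z) + Re (deriv k z) + c * snd p * Im (deriv (deriv h) z)"
    "pdy u p = (c - 1) / 2 * Im (deriv h z) - Im (deriv k z) + c * snd p * Re (deriv (deriv h) z)"
    "pdx v p = (1 + c) / 2 * Im (deriv h z) - Im (deriv k z) + c * snd p * Re (deriv (deriv h) z)"
    "pdy v p = (1 + 3 * c) / 2 * Re (deriv h z) - Re (deriv k z) - c * snd p * Im (deriv (deriv h) z)"
proof -
  note o = open_cdom[OF assms(1)]
  have hol: "h holomorphic_on cdom D" "k holomorphic_on cdom D" "deriv h holomorphic_on cdom D"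
    using assms(2) o by (auto simp: kolosov_def holomorphic_deriv)
  have z: "cpx p \<in> cdom D" using assms(3) by simp
  note d = hol[THEN holomorphic_derivI, OF o z]
  have u: "goursat_on D (\<lambda>z. of_real ((1 + c) / 2) * h z + k z) (\<lambda>z. - \<i> * of_real c * deriv h z) u"
   and v: "goursat_on D (\<lambda>z. - \<i> * of_real ((1 + c) / 2) * h z + \<i> * k z) (\<lambda>z. of_real c * deriv h z) v"
    using assms(2) by (auto simp: kolosov_def)
  have du: "((\<lambda>z. of_real ((1 + c) / 2) * h z + k z) has_field_derivative
      of_real ((1 + c) / 2) * deriv h z + deriv k z) (at (cpx p))"
    "((\<lambda>z. - \<i> * of_real c * deriv h z) has_field_derivative
      - \<i> * of_real c * deriv (deriv h) z) (at (cpx p))"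
    and dv: "((\<lambda>z. - \<i> * of_real ((1 + c) / 2) * h z + \<i> * k z) has_field_derivative
      - \<i> * of_real ((1 + c) / 2) * deriv h z + \<i> * deriv k z) (at (cpx p))"
    "((\<lambda>z. of_real c * deriv h z) has_field_derivative of_real c * deriv (deriv h) z) (at (cpx p))"
    unfolding z_def by (intro DERIV_add DERIV_cmult d)+
  show "pdx u p = (1 + c) / 2 * Re (deriv h z) + Re (deriv k z) + c * snd p * Im (deriv (deriv h) z)"
    "pdy u p = (c - 1) / 2 * Im (deriv h z) - Im (deriv k z) + c * snd p * Re (deriv (deriv h) z)"
    using goursat_on_partial_values[OF assms(1) u assms(3) du] unfolding z_def
    by (simp_all add: algebra_simps add_divide_distrib diff_divide_distrib)
  show "pdx v p = (1 + c) / 2 * Im (deriv h z) - Im (deriv k z) + c * snd p * Re (deriv (deriv h) z)"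
    "pdy v p = (1 + 3 * c) / 2 * Re (deriv h z) - Re (deriv k z) - c * snd p * Im (deriv (deriv h) z)"
    using goursat_on_partial_values[OF assms(1) v assms(3) dv] unfolding z_def
    by (simp_all add: algebra_simps add_divide_distrib diff_divide_distrib)
qed

text \<open>The Laplacians are \<open>2 c Re h''\<close> and \<open>- 2 c Im h''\<close>, and the
  gradient of the dilatation has components \<open>(1 + 2 c) Re h''\<close> and
  \<open>- (1 + 2 c) Im h''\<close>. Both equations thus reduce to
  \<open>2 c + gamma (1 + 2 c) = 0\<close>, that is, to the defining relation of
  \<open>c\<close>.\<close>

lemma kolosov_displacements:
  assumes "open D" "\<mu> > 0" "lam + \<mu> > 0" "kolosov (lame_c lam \<mu>) D h k u v"
  shows "displacements D lam \<mu> u v"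
proof -
  define c where "c = lame_c lam \<mu>"
  define \<gamma> where "\<gamma> = (lam + \<mu>) / \<mu>"
  have "(1 + 2 * c) * (1 + \<gamma>) = 1"
    using lame_c(2)[OF assms(2,3)] by (simp add: c_def \<gamma>_def)
  then have g: "2 * c * t + \<gamma> * ((1 + 2 * c) * t) = 0" for t by algebra
  have K: "kolosov c D h k u v" using assms(4) by (simp add: c_def)
  note o = open_cdom[OF assms(1)]
  have hol: "h holomorphic_on cdom D" "deriv h holomorphic_on cdom D"
    using K o by (auto simp: kolosov_def holomorphic_deriv)
  have u: "goursat_on D (\<lambda>z. of_real ((1 + c) / 2) * h z + k z) (\<lambda>z. - \<i> * of_real c * deriv h z) u"
   and v: "goursat_on D (\<lambda>z. - \<i> * of_real ((1 + c) / 2) * h z + \<i> * k z) (\<lambda>z. of_real c * deriv h z) v"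
    using K by (auto simp: kolosov_def)
  let ?\<theta> = "\<lambda>p. pdx u p + pdy v p"
  have th: "goursat_on D (\<lambda>z. of_real (1 + 2 * c) * deriv h z) (\<lambda>_. 0) ?\<theta>"
  proof -
    have "?\<theta> p = goursat (\<lambda>z. of_real (1 + 2 * c) * deriv h z) (\<lambda>_. 0) p" if "p \<in> D" for p
      using kolosov_first_partials(1,4)[OF assms(1) K that] by (simp add: goursat_def field_simps)
    with hol show ?thesis
      unfolding goursat_on_def by (auto intro!: holomorphic_intros)
  qed
  have "laplace u p + \<gamma> * pdx ?\<theta> p = 0 \<and> laplace v p + \<gamma> * pdy ?\<theta> p = 0" if p: "p \<in> D" for p
  proof -
    have "cpx p \<in> cdom D" using p by simp
    note d = holomorphic_derivI[OF hol(2) o this]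
    have thp: "pdx ?\<theta> p = (1 + 2 * c) * Re (deriv (deriv h) (cpx p))"
      "pdy ?\<theta> p = (1 + 2 * c) * (- Im (deriv (deriv h) (cpx p)))"
      using goursat_on_partial_values[OF assms(1) th p DERIV_cmult[OF d] DERIV_const] by simp_all
    have "deriv (\<lambda>z. - \<i> * of_real c * deriv h z) (cpx p) = - \<i> * of_real c * deriv (deriv h) (cpx p)"
      "deriv (\<lambda>z. of_real c * deriv h z) (cpx p) = of_real c * deriv (deriv h) (cpx p)"
      by (intro DERIV_imp_deriv DERIV_cmult d)+
    then have "laplace u p = 2 * c * Re (deriv (deriv h) (cpx p))"
      "laplace v p = 2 * c * (- Im (deriv (deriv h) (cpx p)))"
      using goursat_on_second_partials(5)[OF assms(1) u] goursat_on_second_partials(5)[OF assms(1) v] p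
      unfolding goursat_on_def goursat_def by simp_all
    with thp g show ?thesis by metis
  qed
  with goursat_on_Ck_on[OF assms(1) u] goursat_on_Ck_on[OF assms(1) v] show ?thesis
    by (simp add: displacements_def \<gamma>_def)
qed

text \<open>The Lame equations, after exchanging mixed second derivatives, are exactly the
  Cauchy-Riemann equations of \<open>P\<close> and \<open>Q\<close>. Only second derivatives of
  \<open>u\<close> and \<open>v\<close> occur, so class \<open>C2\<close> suffices to produce
  \<open>h\<close>.\<close>

lemma displacements_kolosov:
  assumes "open D" "simply_connected D" "\<mu> > 0" "lam + \<mu> > 0" "displacements D lam \<mu> u v"
  obtains h k where "kolosov (lame_c lam \<mu>) D h k u v"
proof -
  define c where "c = lame_c lam \<mu>"
  define \<gamma> where "\<gamma> = (lam + \<mu>) / \<mu>"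
  have g: "(1 + 2 * c) * (1 + \<gamma>) = 1"
    using lame_c(2)[OF assms(3,4)] by (simp add: c_def \<gamma>_def)
  define \<theta> where "\<theta> = (\<lambda>p. pdx u p + pdy v p)"
  have u2: "Ck_on (Suc (Suc 0)) D u" and v2: "Ck_on (Suc (Suc 0)) D v"
    and lame: "\<And>p. p \<in> D \<Longrightarrow> laplace u p + \<gamma> * pdx \<theta> p = 0"
      "\<And>p. p \<in> D \<Longrightarrow> laplace v p + \<gamma> * pdy \<theta> p = 0"
    using assms(5) by (auto simp: displacements_def Let_def numeral_2_eq_2 \<gamma>_def \<theta>_def)
  note Cu = Ck_on_second_partials(1,2)[OF u2] and Cv = Ck_on_second_partials(1,2)[OF v2]
  define P where "P = (\<lambda>p. (1 + \<gamma>) * pdx u p + (1 + \<gamma>) * pdy v p)"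
  define Q where "Q = (\<lambda>p. 1 * pdx v p + (- 1) * pdy u p)"
  have CP: "Ck_on (Suc 0) D P" and CQ: "Ck_on (Suc 0) D Q"
    unfolding P_def Q_def by (intro Ck_on_linear[OF assms(1)] Cu Cv)+
  have CR: "pdx P p = pdy Q p" "pdy P p = - pdx Q p" if p: "p \<in> D" for p
  proof -
    have "pdx \<theta> p = pdx (pdx u) p + pdx (pdy v) p" "pdy \<theta> p = pdy (pdx u) p + pdy (pdy v) p"
      using pdx_pdy_linear[OF Cu(1) Cv(2) p, of 1 1] by (simp_all add: \<theta>_def)
    moreover have "pdx P p = (1 + \<gamma>) * pdx (pdx u) p + (1 + \<gamma>) * pdx (pdy v) p"
      "pdy P p = (1 + \<gamma>) * pdy (pdx u) p + (1 + \<gamma>) * pdy (pdy v) p"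
      unfolding P_def by (rule pdx_pdy_linear[OF Cu(1) Cv(2) p])+
    moreover have "pdx Q p = pdx (pdx v) p - pdx (pdy u) p" "pdy Q p = pdy (pdx v) p - pdy (pdy u) p"
      unfolding Q_def using pdx_pdy_linear[OF Cv(1) Cu(2) p, of 1 "-1"] by simp_all
    ultimately show "pdx P p = pdy Q p" "pdy P p = - pdx Q p"
      using lame[OF p] pdx_pdy_commute[OF assms(1) u2 p] pdx_pdy_commute[OF assms(1) v2 p]
      by (simp_all add: laplace_def algebra_simps)
  qed
  define f where "f = (\<lambda>z. Complex (P (Re z, Im z)) (Q (Re z, Im z)))"
  have "f holomorphic_on cdom D"
    unfolding f_def by (rule cauchy_riemann_holomorphic[OF assms(1) CP CQ CR])
  then obtain h where h: "h holomorphic_on cdom D" "\<And>z. z \<in> cdom D \<Longrightarrow> deriv h z = f z"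
    using primitive_on_cdom[OF assms(1,2)] by blast
  have h': "deriv h holomorphic_on cdom D"
    using h(1) open_cdom[OF assms(1)] by (rule holomorphic_deriv)
  define u0 where "u0 = goursat (\<lambda>z. of_real ((1 + c) / 2) * h z + 0) (\<lambda>z. - \<i> * of_real c * deriv h z)"
  define v0 where "v0 = goursat (\<lambda>z. - \<i> * of_real ((1 + c) / 2) * h z + \<i> * 0) (\<lambda>z. of_real c * deriv h z)"
  have K0: "kolosov c D h (\<lambda>_. 0) u0 v0"
    unfolding kolosov_def goursat_on_def u0_def v0_def using h(1) h'
    by (auto intro!: holomorphic_intros)
  have C0: "Ck_on k D u0" "Ck_on k D v0" for k
    using K0 unfolding kolosov_def by (auto intro: goursat_on_Ck_on[OF assms(1)])
  have Cu1: "Ck_on (Suc 0) D u" and Cv1: "Ck_on (Suc 0) D v"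
    using Ck_on_SucD u2 v2 by blast+
  \<comment> \<open>\<open>u0\<close>, \<open>v0\<close> is the displacement with
    \<open>k = 0\<close>. Subtracting it leaves a field without dilatation and rotation, and these
    two conditions are the Cauchy-Riemann equations for \<open>(u - u0) - i (v - v0)\<close>; this
    is \<open>k\<close>.\<close>
  define R where "R = (\<lambda>p. 1 * u p + (- 1) * u0 p)"
  define S where "S = (\<lambda>p. 1 * v0 p + (- 1) * v p)"
  have CR': "Ck_on (Suc 0) D R" "Ck_on (Suc 0) D S"
    unfolding R_def S_def by (intro Ck_on_linear[OF assms(1)] C0 Cu1 Cv1)+
  have kR: "pdx R p = pdy S p" "pdy R p = - pdx S p" if p: "p \<in> D" for p
  proof -
    note lin = pdx_pdy_linear[OF Cu1 C0(1) p, of 1 "-1"] pdx_pdy_linear[OF C0(2) Cv1 p, of 1 "-1"]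
    have "(1 + 2 * c) * P p = pdx u p + pdy v p"
      using g unfolding P_def by algebra
    moreover have "P p = Re (deriv h (cpx p))" "Q p = Im (deriv h (cpx p))"
      using h(2)[of "cpx p"] p by (simp_all add: f_def)
    moreover have "deriv (\<lambda>_. 0) (cpx p) = 0" by simp
    ultimately show "pdx R p = pdy S p" "pdy R p = - pdx S p"
      using lin kolosov_first_partials[OF assms(1) K0 p]
      by (simp_all add: R_def S_def Q_def field_simps)
  qed
  define k where "k = (\<lambda>z. Complex (R (Re z, Im z)) (S (Re z, Im z)))"
  have k: "k holomorphic_on cdom D"
    unfolding k_def by (rule cauchy_riemann_holomorphic[OF assms(1) CR' kR])
  have "kolosov c D h k u v"
    using K0 k h(1)
    by (auto simp: kolosov_def goursat_on_def goursat_def k_def R_def S_def u0_def v0_def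
        intro!: holomorphic_intros)
  then show thesis using that c_def by simp
qed

text \<open>The conditions on \<open>a\<close> and \<open>b\<close> come from comparing
  coefficients. The sum of the two stress formulas involves only the Laplacian of \<open>W\<close>
  and fixes \<open>b'\<close> as a multiple of \<open>h'\<close>; then
  \<open>W_xx = kappa0 * laplace W - 2 * mu * u_x\<close> fixes \<open>a''\<close>. Both are stated
  in integrated form.\<close>

lemma kolosov_stresses:
  assumes "open D" "\<mu> > 0" "lam + \<mu> > 0" "kolosov (lame_c lam \<mu>) D h k u v" "goursat_on D a b W"
    and b: "\<And>z. z \<in> cdom D \<Longrightarrow> b z = 2 * of_real (\<mu> * lame_c lam \<mu>) * \<i> * h z"
    and a: "\<And>z. z \<in> cdom D \<Longrightarrow> deriv a z = - of_real (\<mu> * lame_c lam \<mu>) * h z - 2 * of_real \<mu> * k z"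
    and p: "p \<in> D"
  shows "2 * \<mu> * pdx u p = C1 lam \<mu> W p" "2 * \<mu> * pdy v p = C2 lam \<mu> W p"
proof -
  define c where "c = lame_c lam \<mu>"
  have K: "kolosov c D h k u v" using assms(4) by (simp add: c_def)
  note o = open_cdom[OF assms(1)]
  have hol: "h holomorphic_on cdom D" "k holomorphic_on cdom D" "deriv h holomorphic_on cdom D"
    using K o by (auto simp: kolosov_def holomorphic_deriv)
  have z: "cpx p \<in> cdom D" using p by simp
  note d = hol[THEN holomorphic_derivI, OF o z]
  have ev: "eventually (\<lambda>z. z \<in> cdom D) (nhds w)" if "w \<in> cdom D" for w
    using o that by (auto simp: eventually_nhds)
  have b1: "deriv b w = 2 * of_real (\<mu> * c) * \<i> * deriv h w" if "w \<in> cdom D" for w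
  proof -
    have "deriv b w = deriv (\<lambda>z. 2 * of_real (\<mu> * c) * \<i> * h z) w"
      using ev[OF that] b by (intro deriv_cong_ev) (auto simp: c_def elim!: eventually_mono)
    then show ?thesis using DERIV_imp_deriv[OF DERIV_cmult[OF holomorphic_derivI[OF hol(1) o that]]] by metis
  qed
  have "deriv (deriv b) (cpx p) = deriv (\<lambda>z. 2 * of_real (\<mu> * c) * \<i> * deriv h z) (cpx p)"
    using ev[OF z] b1 by (intro deriv_cong_ev) (auto elim!: eventually_mono)
  then have b2: "deriv (deriv b) (cpx p) = 2 * of_real (\<mu> * c) * \<i> * deriv (deriv h) (cpx p)"
    using DERIV_imp_deriv[OF DERIV_cmult[OF d(3)]] by metis
  have "deriv (deriv a) (cpx p) = deriv (\<lambda>z. - of_real (\<mu> * c) * h z - 2 * of_real \<mu> * k z) (cpx p)"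
    using ev[OF z] a by (intro deriv_cong_ev) (auto simp: c_def elim!: eventually_mono)
  then have a2: "deriv (deriv a) (cpx p) = - of_real (\<mu> * c) * deriv h (cpx p) - 2 * of_real \<mu> * deriv k (cpx p)"
    using DERIV_imp_deriv[OF DERIV_diff[OF DERIV_cmult[OF d(1)] DERIV_cmult[OF d(2)]]] by metis
  have L: "laplace W p = - 4 * \<mu> * c * Re (deriv h (cpx p))"
    using goursat_on_second_partials(5)[OF assms(1,5)] p b1[OF z]
    by (auto simp: goursat_on_def goursat_def)
  \<comment> \<open>The relation \<open>4 kappa0 c = - 1\<close> turns the factor
    \<open>- 4 mu c\<close> of the Laplacian into \<open>mu\<close>.\<close>
  have "kappa0 lam \<mu> * laplace W p = \<mu> * Re (deriv h (cpx p))"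
    using lame_c(1)[OF assms(2,3)] unfolding L c_def by algebra
  moreover have "pdx (pdx W) p = - \<mu> * c * Re (deriv h (cpx p)) - 2 * \<mu> * Re (deriv k (cpx p))
      - 2 * \<mu> * c * snd p * Im (deriv (deriv h) (cpx p))"
    using goursat_on_second_partials(1)[OF assms(1,5)] p
    by (auto simp: goursat_on_def goursat_def a2 b2)
  moreover from this have "pdy (pdy W) p = - 3 * \<mu> * c * Re (deriv h (cpx p)) + 2 * \<mu> * Re (deriv k (cpx p))
      + 2 * \<mu> * c * snd p * Im (deriv (deriv h) (cpx p))"
    using L by (simp add: laplace_def)
  ultimately show "2 * \<mu> * pdx u p = C1 lam \<mu> W p" "2 * \<mu> * pdy v p = C2 lam \<mu> W p"
    unfolding C1_def C2_def kolosov_first_partials(1,4)[OF assms(1) K p]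
    by (simp_all add: field_simps)
qed

text \<open>Given \<open>h\<close> and \<open>k\<close>, the coefficient \<open>b\<close> is
  explicit, while only the derivative of \<open>a\<close> is prescribed; \<open>a\<close> is
  obtained as a primitive.\<close>

lemma airy_of_displacements:
  assumes "open D" "simply_connected D" "\<mu> > 0" "lam + \<mu> > 0" "displacements D lam \<mu> u v"
  obtains W where "biharmonic_on D W"
    "\<And>p. p \<in> D \<Longrightarrow> 2 * \<mu> * pdx u p = C1 lam \<mu> W p" "\<And>p. p \<in> D \<Longrightarrow> 2 * \<mu> * pdy v p = C2 lam \<mu> W p"
proof -
  obtain h k where K: "kolosov (lame_c lam \<mu>) D h k u v"
    using displacements_kolosov[OF assms] .
  then have hol: "h holomorphic_on cdom D" "k holomorphic_on cdom D" by (auto simp: kolosov_def)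
  define b where "b = (\<lambda>z. 2 * of_real (\<mu> * lame_c lam \<mu>) * \<i> * h z)"
  have "(\<lambda>z. - of_real (\<mu> * lame_c lam \<mu>) * h z - 2 * of_real \<mu> * k z) holomorphic_on cdom D"
    using hol by (intro holomorphic_intros)
  then obtain a where a: "a holomorphic_on cdom D"
    "\<And>z. z \<in> cdom D \<Longrightarrow> deriv a z = - of_real (\<mu> * lame_c lam \<mu>) * h z - 2 * of_real \<mu> * k z"
    using primitive_on_cdom[OF assms(1,2)] by blast
  have G: "goursat_on D a b (goursat a b)"
    using a(1) hol by (auto simp: goursat_on_def b_def intro!: holomorphic_intros)
  show thesis
    using kolosov_stresses[OF assms(1,3,4) K G _ a(2)] goursat_on_biharmonic[OF assms(1) G]
    by (intro that) (simp_all add: b_def)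
qed

text \<open>The relations between the pairs are solved for \<open>h\<close> and \<open>k\<close> by
  division; \<open>mu c\<close> is nonzero because \<open>4 kappa0 c = - 1\<close>.\<close>

lemma displacements_of_airy:
  assumes "open D" "simply_connected D" "\<mu> > 0" "lam + \<mu> > 0" "biharmonic_on D W"
  obtains u v where "displacements D lam \<mu> u v"
    "\<And>p. p \<in> D \<Longrightarrow> 2 * \<mu> * pdx u p = C1 lam \<mu> W p" "\<And>p. p \<in> D \<Longrightarrow> 2 * \<mu> * pdy v p = C2 lam \<mu> W p"
proof -
  obtain a b where G: "goursat_on D a b W"
    using biharmonic_imp_goursat[OF assms(1,2,5)] .
  then have hol: "a holomorphic_on cdom D" "b holomorphic_on cdom D" by (auto simp: goursat_on_def)
  define c where "c = lame_c lam \<mu>"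
  have "\<mu> * c \<noteq> 0" using lame_c(1)[OF assms(3,4)] assms(3) by (auto simp: c_def)
  define h where "h = (\<lambda>z. b z / (2 * of_real (\<mu> * c) * \<i>))"
  define k where "k = (\<lambda>z. - (deriv a z + of_real (\<mu> * c) * h z) / (2 * of_real \<mu>))"
  have a': "deriv a holomorphic_on cdom D"
    using hol(1) open_cdom[OF assms(1)] by (rule holomorphic_deriv)
  have h: "h holomorphic_on cdom D"
    unfolding h_def using hol(2) \<open>\<mu> * c \<noteq> 0\<close> by (auto intro!: holomorphic_intros)
  have k: "k holomorphic_on cdom D"
    unfolding k_def using h a' assms(3) by (auto intro!: holomorphic_intros)
  have h': "deriv h holomorphic_on cdom D"
    using h open_cdom[OF assms(1)] by (rule holomorphic_deriv)
  define u where "u = goursat (\<lambda>z. of_real ((1 + c) / 2) * h z + k z) (\<lambda>z. - \<i> * of_real c * deriv h z)"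
  define v where "v = goursat (\<lambda>z. - \<i> * of_real ((1 + c) / 2) * h z + \<i> * k z) (\<lambda>z. of_real c * deriv h z)"
  have K: "kolosov (lame_c lam \<mu>) D h k u v"
    unfolding kolosov_def goursat_on_def u_def v_def c_def[symmetric] using h k h'
    by (auto intro!: holomorphic_intros)
  have "b z = 2 * of_real (\<mu> * c) * \<i> * h z" "deriv a z = - of_real (\<mu> * c) * h z - 2 * of_real \<mu> * k z" for z
    using \<open>\<mu> * c \<noteq> 0\<close> assms(3) by (simp_all add: h_def k_def)
  with kolosov_stresses[OF assms(1,3,4) K G] kolosov_displacements[OF assms(1,3,4) K] show thesis
    by (intro that) (simp_all add: c_def)
qed

section \<open>Monogenic functions\<close>

lemma bounded_linear_bc: "bounded_linear bc1" "bounded_linear bc2"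
proof -
  have "norm (bc1 z) \<le> norm z * 1" "norm (bc2 z) \<le> norm z * 1" for z
    using norm_fst_le[of "bc1 z" "bc2 z"] norm_snd_le[of "bc2 z" "bc1 z"] by (simp_all add: norm_bih_def)
  then show "bounded_linear bc1" "bounded_linear bc2"
    by (auto intro!: bounded_linear_intro[where K = 1] simp: plus_bih_def scaleR_bih_def)
qed

lemma zeta_eq: "zeta p = Bih (of_real (fst p)) (of_real (snd p))"
  by (simp add: zeta_def e1_def e2_def scaleR_bih_def plus_bih_def scaleR_conv_of_real)

text \<open>Increments in the biharmonic plane become complex increments of equal norm, so the limit
  defining monogenicity can be read as a limit over \<open>c\<close> tending to
  \<open>0\<close>.\<close>

lemma zeta_filterlim:
  "filterlim (\<lambda>c. zeta (Re c, Im c)) (at 0 within bih_plane) (at 0)"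
proof -
  have "((\<lambda>c. zeta (Re c, Im c)) \<longlongrightarrow> 0) (at 0)"
  proof (rule tendsto_norm_zero_cancel)
    have "norm (zeta (Re c, Im c)) = norm c" for c
      by (simp add: zeta_eq norm_bih_def norm_Pair cmod_def)
    then show "((\<lambda>c. norm (zeta (Re c, Im c))) \<longlongrightarrow> 0) (at 0)"
      by (simp add: tendsto_norm_zero)
  qed
  moreover have "eventually (\<lambda>c. zeta (Re c, Im c) \<in> bih_plane \<and> zeta (Re c, Im c) \<noteq> 0) (at 0)"
    unfolding eventually_at_filter
  proof (intro always_eventually allI impI conjI)
    show "zeta (Re c, Im c) \<in> bih_plane" for c
      by (simp add: bih_plane_def)
  qed (auto simp: zeta_eq zero_bih_def complex_eq_iff)
  ultimately show ?thesis
    by (simp add: filterlim_at conj_commute)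
qed

text \<open>Sending \<open>e2\<close> to \<open>i\<close> is a ring homomorphism onto the complex
  numbers, and it maps \<open>zeta (x, y)\<close> to \<open>x + i y\<close>; this is the first
  identity. The second is the coefficient of the nilpotent \<open>n = e2 - i\<close>: with
  \<open>Bih a b = (a + i b) + b n\<close>, the inverse of \<open>c + y n\<close> is
  \<open>1 / c - y n / c\<^sup>2\<close>.\<close>

lemma bih_quotient:
  fixes w :: bih
  assumes "c \<noteq> 0"
  defines "q \<equiv> w * inverse (zeta (Re c, Im c))"
  shows "bc1 q + \<i> * bc2 q = (bc1 w + \<i> * bc2 w) / c"
    "bc2 q = bc2 w / c - of_real (Im c) * ((bc1 w + \<i> * bc2 w) / c) / c"
proof -
  have "c = of_real (Re c) + \<i> * of_real (Im c)" by (simp add: complex_eq_iff)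
  then obtain x y where c: "c = of_real x + \<i> * of_real y" "x = Re c" "y = Im c" by blast
  have i: "inverse (zeta (Re c, Im c)) = Bih ((of_real x + 2 * \<i> * of_real y) / c\<^sup>2) (- of_real y / c\<^sup>2)"
    using c by (simp add: inverse_bih_def zeta_eq)
  have x: "of_real x = c - \<i> * of_real y" using c(1) by simp
  show "bc1 q + \<i> * bc2 q = (bc1 w + \<i> * bc2 w) / c"
    unfolding q_def i using assms(1)
    by (simp add: times_bih_def x field_simps power2_eq_square)
  show "bc2 q = bc2 w / c - of_real (Im c) * ((bc1 w + \<i> * bc2 w) / c) / c"
    unfolding q_def i unfolding c(3)[symmetric] using assms(1)
    by (simp add: times_bih_def x field_simps power2_eq_square)
qed

text \<open>
  Here \<open>e2 - \<i>\<close> is nilpotent and \<open>\<zeta> = z + y (e2 - \<i>)\<close>, so that \<open>\<Phi>(\<zeta>) = F(z) + B(\<zeta>) (e2 - \<i>)\<close>;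
  the \<open>e2 - \<i>\<close> component of the difference quotient then shows that \<open>B - y F'\<close> is holomorphic.
\<close>

lemma monogenic_decomposition:
  assumes "open D" "monogenic_on (zeta ` D) \<Phi>"
  obtains F G where "F holomorphic_on cdom D" "G holomorphic_on cdom D"
    "\<And>p. p \<in> D \<Longrightarrow> bc1 (\<Phi> (zeta p)) + \<i> * bc2 (\<Phi> (zeta p)) = F (cpx p)"
    "\<And>p. p \<in> D \<Longrightarrow> bc2 (\<Phi> (zeta p)) = G (cpx p) + of_real (snd p) * deriv F (cpx p)"
proof -
  define B where "B z = bc2 (\<Phi> (zeta (Re z, Im z)))" for z
  define A where "A z = bc1 (\<Phi> (zeta (Re z, Im z))) + \<i> * B z" for z
  have lim: "\<exists>d e. ((\<lambda>c. (A (z + c) - A z) / c) \<longlongrightarrow> d) (at 0) \<and>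
      ((\<lambda>c. (B (z + c) - B z) / c - of_real (Im c) * ((A (z + c) - A z) / c) / c) \<longlongrightarrow> e) (at 0)"
    if z: "z \<in> cdom D" for z
  proof -
    let ?q = "\<lambda>c. (\<Phi> (zeta (Re z, Im z) + zeta (Re c, Im c)) - \<Phi> (zeta (Re z, Im z))) * inverse (zeta (Re c, Im c))"
    have "zeta (Re z, Im z) \<in> zeta ` D" using z by (simp add: cdom_def)
    then obtain d where "((\<lambda>h. (\<Phi> (zeta (Re z, Im z) + h) - \<Phi> (zeta (Re z, Im z))) * inverse h) \<longlongrightarrow> d) (at 0 within bih_plane)"
      using assms(2) by (auto simp: monogenic_on_def)
    then have q: "(?q \<longlongrightarrow> d) (at 0)"
      by (rule filterlim_compose[OF _ zeta_filterlim])
    have q12: "((\<lambda>c. bc1 (?q c) + \<i> * bc2 (?q c)) \<longlongrightarrow> bc1 d + \<i> * bc2 d) (at 0)"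
      "((\<lambda>c. bc2 (?q c)) \<longlongrightarrow> bc2 d) (at 0)"
      using bounded_linear.tendsto[OF bounded_linear_bc(1) q] bounded_linear.tendsto[OF bounded_linear_bc(2) q]
      by (auto intro!: tendsto_intros)
    have z: "zeta (Re z, Im z) + zeta (Re c, Im c) = zeta (Re (z + c), Im (z + c))" for c
      by (simp add: zeta_eq plus_bih_def)
    have ev: "eventually (\<lambda>c. bc1 (?q c) + \<i> * bc2 (?q c) = (A (z + c) - A z) / c) (at 0)"
      "eventually (\<lambda>c. bc2 (?q c) = (B (z + c) - B z) / c - of_real (Im c) * ((A (z + c) - A z) / c) / c) (at 0)"
      unfolding z eventually_at_filter
      by (rule always_eventually, intro allI impI, subst bih_quotient, simp,
        simp add: A_def B_def minus_bih_def algebra_simps)+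
    from Lim_transform_eventually[OF q12(1) ev(1)] Lim_transform_eventually[OF q12(2) ev(2)] show ?thesis
      by blast
  qed
  have A: "A holomorphic_on cdom D"
  proof (rule holomorphic_onI)
    fix z assume "z \<in> cdom D"
    then have "A field_differentiable at z"
      using lim unfolding field_differentiable_def DERIV_def by blast
    then show "A field_differentiable at z within cdom D"
      by (rule field_differentiable_at_within)
  qed
  note o = open_cdom[OF assms(1)]
  define G where "G z = B z - of_real (Im z) * deriv A z" for z
  have "G holomorphic_on cdom D"
  proof (rule holomorphic_onI)
    fix z assume z: "z \<in> cdom D"
    from lim[OF z] obtain e where
      e: "((\<lambda>c. (B (z + c) - B z) / c - of_real (Im c) * ((A (z + c) - A z) / c) / c) \<longlongrightarrow> e) (at 0)"
      by blast
    have dA: "((\<lambda>c. (A (z + c) - A z) / c) \<longlongrightarrow> deriv A z) (at 0)"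
      using holomorphic_derivI[OF A o z, of UNIV] by (simp add: DERIV_def)
    have dA': "((\<lambda>c. (deriv A (z + c) - deriv A z) / c) \<longlongrightarrow> deriv (deriv A) z) (at 0)"
      using holomorphic_derivI[OF holomorphic_deriv[OF A o] o z, of UNIV] by (simp add: DERIV_def)
    have "isCont (deriv A) z"
      using holomorphic_derivI[OF holomorphic_deriv[OF A o] o z] DERIV_isCont by blast
    then have "((\<lambda>c. deriv A (z + c)) \<longlongrightarrow> deriv A z) (at 0)"
      by (simp add: isCont_def LIM_offset_zero_iff)
    from tendsto_diff[OF dA this]
    have "((\<lambda>c. (A (z + c) - A z) / c - deriv A (z + c)) \<longlongrightarrow> 0) (at 0)" by simp
    then have "((\<lambda>c. norm ((A (z + c) - A z) / c - deriv A (z + c))) \<longlongrightarrow> 0) (at 0)"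
      by (rule tendsto_norm_zero)
    \<comment> \<open>The quotient \<open>Im c / c\<close> has no limit, but its modulus is at most
      one and it multiplies a quantity tending to zero.\<close>
    then have m: "((\<lambda>c. of_real (Im c) / c * ((A (z + c) - A z) / c - deriv A (z + c))) \<longlongrightarrow> 0) (at 0)"
    proof (rule Lim_null_comparison[rotated])
      have "norm (of_real (Im c) / c * w) \<le> norm w" for c w :: complex
      proof -
        have "norm (of_real (Im c) / c) \<le> 1"
          using abs_Im_le_cmod[of c] by (cases "c = 0") (simp_all add: norm_divide)
        from mult_right_mono[OF this norm_ge_zero[of w]] show ?thesis by (simp only: norm_mult mult_1)
      qed
      then show "eventually (\<lambda>c. norm (of_real (Im c) / c * ((A (z + c) - A z) / c - deriv A (z + c)))
          \<le> norm ((A (z + c) - A z) / c - deriv A (z + c))) (at 0)"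
        by simp
    qed
    \<comment> \<open>A regrouping of the difference quotient of \<open>G\<close>: the known
      nilpotent part, the vanishing term \<open>m\<close>, and the quotient of the derivative of
      \<open>A\<close> with the factor \<open>Im z\<close> frozen.\<close>
    have "((\<lambda>c. ((B (z + c) - B z) / c - of_real (Im c) * ((A (z + c) - A z) / c) / c)
        + of_real (Im c) / c * ((A (z + c) - A z) / c - deriv A (z + c))
        - of_real (Im z) * ((deriv A (z + c) - deriv A z) / c)) \<longlongrightarrow> e + 0 - of_real (Im z) * deriv (deriv A) z) (at 0)"
      by (intro tendsto_intros e m dA')
    moreover have "eventually (\<lambda>c. ((B (z + c) - B z) / c - of_real (Im c) * ((A (z + c) - A z) / c) / c)
        + of_real (Im c) / c * ((A (z + c) - A z) / c - deriv A (z + c))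
        - of_real (Im z) * ((deriv A (z + c) - deriv A z) / c) = (G (z + c) - G z) / c) (at 0)"
      unfolding eventually_at_filter
      by (intro always_eventually allI impI) (simp add: G_def field_simps)
    ultimately have "((\<lambda>c. (G (z + c) - G z) / c) \<longlongrightarrow> e + 0 - of_real (Im z) * deriv (deriv A) z) (at 0)"
      by (rule Lim_transform_eventually)
    then have "G field_differentiable at z"
      unfolding field_differentiable_def DERIV_def by blast
    then show "G field_differentiable at z within cdom D"
      by (rule field_differentiable_at_within)
  qed
  with A show thesis
    by (rule that) (simp_all add: A_def B_def G_def)
qed

text \<open>The decomposition gives \<open>U1 = Re (F - i G - i y F')\<close>, to be matched with
  \<open>Re (a'' + y b'')\<close>; hence one primitive for \<open>b\<close> and two for
  \<open>a\<close>. As \<open>U1 - U4 = Re F\<close>, the Laplacian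
  \<open>Re (2 i b') = 2 Re F\<close> supplies \<open>W_yy\<close>.\<close>

lemma monogenic_generates_biharmonic:
  assumes "open D" "simply_connected D" "monogenic_on (zeta ` D) \<Phi>"
  obtains W where "biharmonic_on D W" "\<And>p. p \<in> D \<Longrightarrow> pdx (pdx W) p = U1 \<Phi> p"
    "\<And>p. p \<in> D \<Longrightarrow> pdy (pdy W) p = U1 \<Phi> p - 2 * U4 \<Phi> p"
proof -
  note o = open_cdom[OF assms(1)]
  obtain F G where F: "F holomorphic_on cdom D" and G: "G holomorphic_on cdom D"
    and Phi: "\<And>p. p \<in> D \<Longrightarrow> bc1 (\<Phi> (zeta p)) + \<i> * bc2 (\<Phi> (zeta p)) = F (cpx p)"
      "\<And>p. p \<in> D \<Longrightarrow> bc2 (\<Phi> (zeta p)) = G (cpx p) + of_real (snd p) * deriv F (cpx p)"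
    using monogenic_decomposition[OF assms(1,3)] by blast
  have "(\<lambda>z. - \<i> * F z) holomorphic_on cdom D"
    using F by (intro holomorphic_intros)
  then obtain b where b: "b holomorphic_on cdom D" "\<And>z. z \<in> cdom D \<Longrightarrow> deriv b z = - \<i> * F z"
    using primitive_on_cdom[OF assms(1,2)] by blast
  have "(\<lambda>z. F z - \<i> * G z) holomorphic_on cdom D"
    using F G by (intro holomorphic_intros)
  then obtain a1 where a1: "a1 holomorphic_on cdom D" "\<And>z. z \<in> cdom D \<Longrightarrow> deriv a1 z = F z - \<i> * G z"
    using primitive_on_cdom[OF assms(1,2)] by blast
  obtain a where a: "a holomorphic_on cdom D" "\<And>z. z \<in> cdom D \<Longrightarrow> deriv a z = a1 z"
    using primitive_on_cdom[OF assms(1,2) a1(1)] by blast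
  let ?W = "goursat a b"
  have W: "goursat_on D a b ?W" using a(1) b(1) by (simp add: goursat_on_def)
  have ev: "eventually (\<lambda>z. z \<in> cdom D) (nhds w)" if "w \<in> cdom D" for w
    using o that by (auto simp: eventually_nhds)
  have xx: "pdx (pdx ?W) p = U1 \<Phi> p" and L: "laplace ?W p = 2 * U1 \<Phi> p - 2 * U4 \<Phi> p" if p: "p \<in> D" for p
  proof -
    have z: "cpx p \<in> cdom D" using p by simp
    have "deriv (deriv a) (cpx p) = deriv a1 (cpx p)"
      using ev[OF z] a(2) by (intro deriv_cong_ev) (auto elim!: eventually_mono)
    then have a2: "deriv (deriv a) (cpx p) = F (cpx p) - \<i> * G (cpx p)" using a1(2)[OF z] by simp
    have "deriv (deriv b) (cpx p) = deriv (\<lambda>z. - \<i> * F z) (cpx p)"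
      using ev[OF z] b(2) by (intro deriv_cong_ev) (auto elim!: eventually_mono)
    then have b2: "deriv (deriv b) (cpx p) = - \<i> * deriv F (cpx p)"
      using DERIV_imp_deriv[OF DERIV_cmult[OF holomorphic_derivI[OF F o z]]] by metis
    have "bc1 (\<Phi> (zeta p)) = F (cpx p) - \<i> * (G (cpx p) + of_real (snd p) * deriv F (cpx p))"
      using Phi[OF p] by (simp add: algebra_simps)
    with Phi(2)[OF p] goursat_on_second_partials(1,5)[OF assms(1) W] p b(2)[OF z]
    show "pdx (pdx ?W) p = U1 \<Phi> p" "laplace ?W p = 2 * U1 \<Phi> p - 2 * U4 \<Phi> p"
      by (auto simp: goursat_on_def goursat_def a2 b2 U1_def U4_def)
  qed
  show thesis
    using that[OF goursat_on_biharmonic[OF assms(1) W] xx] xx L by (fastforce simp: laplace_def)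
qed

section \<open>Boundary values\<close>

text \<open>Existence and value of the boundary limits in one relation, which, unlike
  \<open>cl_ext\<close> with its \<open>Lim\<close>, passes directly through linear
  combinations.\<close>

definition has_boundary_values ::
  "(real \<times> real) set \<Rightarrow> (real \<times> real \<Rightarrow> real) \<Rightarrow> (real \<times> real \<Rightarrow> real) \<Rightarrow> bool" where
  "has_boundary_values D \<tau> g \<longleftrightarrow>
    continuous_on D \<tau> \<and> (\<forall>p\<in>frontier D. (\<tau> \<longlongrightarrow> g p) (at p within D))"

lemma at_frontier_nontrivial:
  assumes "open D" "p \<in> frontier D" shows "p \<notin> D" "at p within D \<noteq> bot"
  using assms by (auto simp: frontier_def interior_open closure_def trivial_limit_within)

text \<open>A frontier point of an open set lies outside it and is a limit point, so
  \<open>cl_ext\<close> takes its \<open>Lim\<close> branch there and the limit is unique.\<close>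

lemma has_boundary_values_iff:
  assumes "open D"
  shows "has_boundary_values D \<tau> g \<longleftrightarrow> cont_cl D \<tau> \<and> (\<forall>p\<in>frontier D. cl_ext D \<tau> p = g p)"
proof -
  have "(\<tau> \<longlongrightarrow> g p) (at p within D) \<longleftrightarrow> (\<exists>l. (\<tau> \<longlongrightarrow> l) (at p within D)) \<and> cl_ext D \<tau> p = g p"
    if "p \<in> frontier D" for p
    using at_frontier_nontrivial[OF assms that] tendsto_Lim by (fastforce simp: cl_ext_def)
  then show ?thesis by (auto simp: has_boundary_values_def cont_cl_def)
qed

lemma has_boundary_values_linear:
  assumes "has_boundary_values D \<tau> g" "has_boundary_values D \<sigma> h"
    and "\<And>p. p \<in> D \<Longrightarrow> \<rho> p = c * \<tau> p + d * \<sigma> p"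
    and "\<And>p. p \<in> frontier D \<Longrightarrow> k p = c * g p + d * h p"
  shows "has_boundary_values D \<rho> k"
  unfolding has_boundary_values_def
proof (intro conjI ballI)
  have "continuous_on D (\<lambda>p. c * \<tau> p + d * \<sigma> p)"
    using assms(1,2) by (intro continuous_intros) (auto simp: has_boundary_values_def)
  then show "continuous_on D \<rho>" using assms(3) by (simp cong: continuous_on_cong)
  fix p assume p: "p \<in> frontier D"
  have "((\<lambda>p. c * \<tau> p + d * \<sigma> p) \<longlongrightarrow> k p) (at p within D)"
    unfolding assms(4)[OF p] using assms(1,2) p by (intro tendsto_intros) (auto simp: has_boundary_values_def)
  moreover have "eventually (\<lambda>p. c * \<tau> p + d * \<sigma> p = \<rho> p) (at p within D)"
    using assms(3) by (auto simp: eventually_at_filter)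
  ultimately show "(\<rho> \<longlongrightarrow> k p) (at p within D)" by (rule Lim_transform_eventually)
qed

lemma problem_ux_vy_iff:
  assumes "open D"
  shows "problem_ux_vy D lam \<mu> g1 g2 V1 V2 \<longleftrightarrow>
    (\<exists>u v. displacements D lam \<mu> u v \<and> (\<forall>p\<in>D. V1 p = pdx u p \<and> V2 p = pdy v p)) \<and>
    has_boundary_values D V1 g1 \<and> has_boundary_values D V2 g2"
  unfolding problem_ux_vy_def has_boundary_values_iff[OF assms] by blast

text \<open>Here \<open>s\<close> and \<open>t\<close> stand for \<open>W_xx\<close> and
  \<open>W_yy\<close>. The system has determinant \<open>1 - 2 kappa0\<close>, which is nonzero; it
  is used both for boundary values and pointwise in \<open>D\<close>.\<close>

lemma C1_C2_solve:
  assumes "\<mu> > 0" "lam + \<mu> > 0"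
  defines "\<kappa> \<equiv> kappa0 lam \<mu>"
  shows "(\<kappa> - 1) * s + \<kappa> * t = 2 * \<mu> * x \<and> \<kappa> * s + (\<kappa> - 1) * t = 2 * \<mu> * y \<longleftrightarrow>
    s = lam * x + (lam + 2 * \<mu>) * y \<and> t = (lam + 2 * \<mu>) * x + lam * y"
proof -
  have k: "2 * \<kappa> * (lam + \<mu>) = lam + 2 * \<mu>"
  proof -
    obtain s where "lam = s - \<mu>" "s > 0" using assms(2) that[of "lam + \<mu>"] by simp
    then show ?thesis unfolding \<kappa>_def kappa0_def by simp
  qed
  show ?thesis
  proof (intro iffI; elim conjE)
    assume eq: "(\<kappa> - 1) * s + \<kappa> * t = 2 * \<mu> * x" "\<kappa> * s + (\<kappa> - 1) * t = 2 * \<mu> * y"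
    have "s - t = 2 * \<mu> * y - 2 * \<mu> * x"
      using eq by algebra
    \<comment> \<open>The sum of the equations is
      \<open>(2 kappa0 - 1) (s + t) = 2 mu (x + y)\<close>; multiplying by \<open>lam + mu\<close>
      clears \<open>kappa0\<close>.\<close>
    moreover have "\<mu> * (s + t) = \<mu> * (2 * (lam + \<mu>) * (x + y))"
      using eq k by algebra
    then have "s + t = 2 * (lam + \<mu>) * (x + y)"
      using assms(1) by simp
    ultimately show "s = lam * x + (lam + 2 * \<mu>) * y \<and> t = (lam + 2 * \<mu>) * x + lam * y"
      by (simp add: algebra_simps)
  next
    assume "s = lam * x + (lam + 2 * \<mu>) * y" "t = (lam + 2 * \<mu>) * x + lam * y"
    then show "(\<kappa> - 1) * s + \<kappa> * t = 2 * \<mu> * x \<and> \<kappa> * s + (\<kappa> - 1) * t = 2 * \<mu> * y"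
      using k by algebra
  qed
qed

lemma C1_C2_eq:
  "C1 lam \<mu> W p = (kappa0 lam \<mu> - 1) * pdx (pdx W) p + kappa0 lam \<mu> * pdy (pdy W) p"
  "C2 lam \<mu> W p = kappa0 lam \<mu> * pdx (pdx W) p + (kappa0 lam \<mu> - 1) * pdy (pdy W) p"
  by (simp_all add: C1_def C2_def laplace_def algebra_simps)

lemma has_boundary_values_C1_C2:
  assumes "has_boundary_values D (pdx (pdx W)) l1" "has_boundary_values D (pdy (pdy W)) l2"
  shows "has_boundary_values D (C1 lam \<mu> W) (\<lambda>p. (kappa0 lam \<mu> - 1) * l1 p + kappa0 lam \<mu> * l2 p)"
    "has_boundary_values D (C2 lam \<mu> W) (\<lambda>p. kappa0 lam \<mu> * l1 p + (kappa0 lam \<mu> - 1) * l2 p)"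
  by (rule has_boundary_values_linear[OF assms]; simp add: C1_C2_eq)+

text \<open>Class \<open>C2_cl\<close> guarantees limits of \<open>W_xx\<close> and
  \<open>W_yy\<close>, so the conditions on \<open>C1\<close> and \<open>C2\<close> pass to these
  limits and the linear system can be solved at each frontier point. The result is a pair of
  Dirichlet conditions.\<close>

lemma biharmonic_problem_iff:
  assumes "open D" "\<mu> > 0" "lam + \<mu> > 0"
  shows "biharmonic_problem D lam \<mu> g1 g2 W \<longleftrightarrow> biharmonic_on D W \<and>
    has_boundary_values D (pdx (pdx W)) (\<lambda>p. lam * g1 p + (lam + 2 * \<mu>) * g2 p) \<and>
    has_boundary_values D (pdy (pdy W)) (\<lambda>p. (lam + 2 * \<mu>) * g1 p + lam * g2 p)"
    (is "?L \<longleftrightarrow> _ \<and> has_boundary_values D _ ?h1 \<and> has_boundary_values D _ ?h2")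
proof (intro iffI; (elim conjE)?)
  assume L: ?L
  then have bv: "has_boundary_values D (pdx (pdx W)) (cl_ext D (pdx (pdx W)))"
    "has_boundary_values D (pdy (pdy W)) (cl_ext D (pdy (pdy W)))"
    unfolding has_boundary_values_iff[OF assms(1)] by (auto simp: biharmonic_problem_def C2_cl_def)
  have "cl_ext D (pdx (pdx W)) p = ?h1 p \<and> cl_ext D (pdy (pdy W)) p = ?h2 p" if "p \<in> frontier D" for p
    using has_boundary_values_C1_C2[OF bv] L that C1_C2_solve[OF assms(2,3)]
    unfolding has_boundary_values_iff[OF assms(1)] biharmonic_problem_def by metis
  with bv L show "biharmonic_on D W \<and> has_boundary_values D (pdx (pdx W)) ?h1 \<and> has_boundary_values D (pdy (pdy W)) ?h2"
    unfolding has_boundary_values_iff[OF assms(1)] biharmonic_problem_def by simp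
next
  assume W: "biharmonic_on D W" and bv: "has_boundary_values D (pdx (pdx W)) ?h1" "has_boundary_values D (pdy (pdy W)) ?h2"
  have "(kappa0 lam \<mu> - 1) * ?h1 p + kappa0 lam \<mu> * ?h2 p = 2 * \<mu> * g1 p \<and>
      kappa0 lam \<mu> * ?h1 p + (kappa0 lam \<mu> - 1) * ?h2 p = 2 * \<mu> * g2 p" for p
    unfolding C1_C2_solve[OF assms(2,3)] by simp
  with W bv has_boundary_values_C1_C2[OF bv, of lam \<mu>] show ?L
    unfolding has_boundary_values_iff[OF assms(1)] biharmonic_problem_def C2_cl_def
    by simp
qed

text \<open>The conditions in \<open>biharmonic_problem\<close> prescribe values of
  \<open>cl_ext\<close>; that \<open>C1\<close> and \<open>C2\<close> really converge at the
  frontier comes from the convergence of \<open>W_xx\<close> and \<open>W_yy\<close>.\<close>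

lemma biharmonic_problem_stress_boundary_values:
  assumes "open D" "\<mu> > 0" "lam + \<mu> > 0" "biharmonic_problem D lam \<mu> g1 g2 W"
  shows "has_boundary_values D (C1 lam \<mu> W) (\<lambda>p. 2 * \<mu> * g1 p)"
    "has_boundary_values D (C2 lam \<mu> W) (\<lambda>p. 2 * \<mu> * g2 p)"
proof -
  have "has_boundary_values D (pdx (pdx W)) (\<lambda>p. lam * g1 p + (lam + 2 * \<mu>) * g2 p)"
    "has_boundary_values D (pdy (pdy W)) (\<lambda>p. (lam + 2 * \<mu>) * g1 p + lam * g2 p)"
    using assms(4) unfolding biharmonic_problem_iff[OF assms(1-3)] by blast+
  from has_boundary_values_C1_C2[OF this, of lam \<mu>] assms(4)
  show "has_boundary_values D (C1 lam \<mu> W) (\<lambda>p. 2 * \<mu> * g1 p)"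
    "has_boundary_values D (C2 lam \<mu> W) (\<lambda>p. 2 * \<mu> * g2 p)"
    unfolding has_boundary_values_iff[OF assms(1)] biharmonic_problem_def by blast+
qed

lemma biharmonic_problem_unique:
  assumes "open D" "simply_connected D" "D \<noteq> {}" "bounded D" "\<mu> > 0" "lam + \<mu> > 0"
    and "biharmonic_problem D lam \<mu> g1 g2 W" "biharmonic_problem D lam \<mu> g1 g2 W'" "q \<in> D"
  shows "pdx (pdx W) q = pdx (pdx W') q" "pdy (pdy W) q = pdy (pdy W') q"
proof -
  have W: "biharmonic_on D W" "biharmonic_on D W'"
    using assms(7,8) by (simp_all add: biharmonic_problem_def)
  have lim: "((\<lambda>p. pdx (pdx W) p - pdx (pdx W') p) \<longlongrightarrow> 0) (at p within D)"
    "((\<lambda>p. pdy (pdy W) p - pdy (pdy W') p) \<longlongrightarrow> 0) (at p within D)" if "p \<in> frontier D" for p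
  proof -
    have "((\<lambda>p. pdx (pdx V) p) \<longlongrightarrow> lam * g1 p + (lam + 2 * \<mu>) * g2 p) (at p within D)"
      "((\<lambda>p. pdy (pdy V) p) \<longlongrightarrow> (lam + 2 * \<mu>) * g1 p + lam * g2 p) (at p within D)"
      if "biharmonic_problem D lam \<mu> g1 g2 V" for V
      using that \<open>p \<in> frontier D\<close>
      unfolding biharmonic_problem_iff[OF assms(1,5,6)] has_boundary_values_def by blast+
    from tendsto_diff[OF this(1)[OF assms(7)] this(1)[OF assms(8)]]
      tendsto_diff[OF this(2)[OF assms(7)] this(2)[OF assms(8)]]
    show "((\<lambda>p. pdx (pdx W) p - pdx (pdx W') p) \<longlongrightarrow> 0) (at p within D)"
      "((\<lambda>p. pdy (pdy W) p - pdy (pdy W') p) \<longlongrightarrow> 0) (at p within D)"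
      by simp_all
  qed
  show "pdx (pdx W) q = pdx (pdx W') q" "pdy (pdy W) q = pdy (pdy W') q"
    by (rule biharmonic_second_partials_unique[OF assms(1-4) W lim assms(9)]; assumption)+
qed

section \<open>The boundary value problems\<close>

lemma problem_ux_vy_airy:
  assumes "open D" "simply_connected D" "\<mu> > 0" "lam + \<mu> > 0"
  shows "problem_ux_vy D lam \<mu> g1 g2 V1 V2 \<longleftrightarrow>
    (\<exists>W. biharmonic_problem D lam \<mu> g1 g2 W \<and>
      (\<forall>p\<in>D. 2 * \<mu> * V1 p = C1 lam \<mu> W p \<and> 2 * \<mu> * V2 p = C2 lam \<mu> W p))"
    (is "?L \<longleftrightarrow> ?R")
proof
  assume L: ?L
  then obtain u v where uv: "displacements D lam \<mu> u v" "\<And>p. p \<in> D \<Longrightarrow> V1 p = pdx u p \<and> V2 p = pdy v p"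
    and bv: "has_boundary_values D V1 g1" "has_boundary_values D V2 g2"
    unfolding problem_ux_vy_iff[OF assms(1)] by blast
  obtain W where W: "biharmonic_on D W" "\<And>p. p \<in> D \<Longrightarrow> 2 * \<mu> * V1 p = C1 lam \<mu> W p"
    "\<And>p. p \<in> D \<Longrightarrow> 2 * \<mu> * V2 p = C2 lam \<mu> W p"
    using airy_of_displacements[OF assms uv(1)] uv(2) by metis
  \<comment> \<open>The Airy function comes without boundary regularity. Solving the stress formulas
    inside \<open>D\<close> expresses its second derivatives through \<open>V1\<close> and
    \<open>V2\<close>, whose limits are known.\<close>
  have "pdx (pdx W) p = lam * V1 p + (lam + 2 * \<mu>) * V2 p \<and>
      pdy (pdy W) p = (lam + 2 * \<mu>) * V1 p + lam * V2 p" if "p \<in> D" for p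
    using C1_C2_solve[OF assms(3,4)] W(2,3)[OF that] unfolding C1_C2_eq by metis
  then have "has_boundary_values D (pdx (pdx W)) (\<lambda>p. lam * g1 p + (lam + 2 * \<mu>) * g2 p)"
    "has_boundary_values D (pdy (pdy W)) (\<lambda>p. (lam + 2 * \<mu>) * g1 p + lam * g2 p)"
    by (auto intro!: has_boundary_values_linear[OF bv])
  then have "biharmonic_problem D lam \<mu> g1 g2 W"
    using W(1) by (simp add: biharmonic_problem_iff[OF assms(1,3,4)])
  with W show ?R by blast
next
  assume ?R
  then obtain W where W: "biharmonic_problem D lam \<mu> g1 g2 W"
    and V: "\<And>p. p \<in> D \<Longrightarrow> 2 * \<mu> * V1 p = C1 lam \<mu> W p" "\<And>p. p \<in> D \<Longrightarrow> 2 * \<mu> * V2 p = C2 lam \<mu> W p"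
    by blast
  obtain u v where uv: "displacements D lam \<mu> u v"
    "\<And>p. p \<in> D \<Longrightarrow> 2 * \<mu> * pdx u p = C1 lam \<mu> W p" "\<And>p. p \<in> D \<Longrightarrow> 2 * \<mu> * pdy v p = C2 lam \<mu> W p"
    using displacements_of_airy[OF assms] W by (metis biharmonic_problem_def)
  have "V1 p = pdx u p" "V2 p = pdy v p" if "p \<in> D" for p
    using V[OF that] uv(2,3)[OF that, symmetric] assms(3) by simp_all
  moreover note bv = biharmonic_problem_stress_boundary_values[OF assms(1,3,4) W]
  have "has_boundary_values D V1 g1"
    by (rule has_boundary_values_linear[OF bv(1,1), where c = "1 / (2 * \<mu>)" and d = 0])
      (use V(1) assms(3) in \<open>simp_all add: field_simps\<close>)
  moreover have "has_boundary_values D V2 g2"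
    by (rule has_boundary_values_linear[OF bv(2,2), where c = "1 / (2 * \<mu>)" and d = 0])
      (use V(2) assms(3) in \<open>simp_all add: field_simps\<close>)
  ultimately show ?L
    using uv(1) unfolding problem_ux_vy_iff[OF assms(1)] by blast
qed

theorem theorem4:
  fixes D :: "(real \<times> real) set" and lam \<mu> :: real and g1 g2 :: "real \<times> real \<Rightarrow> real"
  assumes "open D" "connected D" "D \<noteq> {}" "bounded D" "simply_connected D"
    and "\<mu> > 0" "lam + \<mu> > 0"
  shows
    "((\<forall>W V1 V2. biharmonic_problem D lam \<mu> g1 g2 W \<and>
          (\<forall>p\<in>D. 2 * \<mu> * V1 p = C1 lam \<mu> W p \<and> 2 * \<mu> * V2 p = C2 lam \<mu> W p)
          \<longrightarrow> problem_ux_vy D lam \<mu> g1 g2 V1 V2) \<and>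
      (\<forall>V1 V2. problem_ux_vy D lam \<mu> g1 g2 V1 V2 \<longrightarrow>
          (\<exists>W. biharmonic_problem D lam \<mu> g1 g2 W \<and>
            (\<forall>p\<in>D. 2 * \<mu> * V1 p = C1 lam \<mu> W p \<and> 2 * \<mu> * V2 p = C2 lam \<mu> W p))))
     \<and>
     (\<forall>\<Phi>. problem_1_4 D (\<lambda>p. lam * g1 p + (lam + 2 * \<mu>) * g2 p) (\<lambda>p. - \<mu> * g1 p + \<mu> * g2 p) \<Phi> \<longrightarrow>
        (\<exists>W. biharmonic_problem D lam \<mu> g1 g2 W \<and>
          (\<forall>p\<in>D. pdx (pdx W) p = U1 \<Phi> p \<and> pdy (pdy W) p = U1 \<Phi> p - 2 * U4 \<Phi> p)) \<and>
        (\<forall>W. biharmonic_problem D lam \<mu> g1 g2 W \<longrightarrow>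
          (\<forall>p\<in>D. pdx (pdx W) p = U1 \<Phi> p \<and> pdy (pdy W) p = U1 \<Phi> p - 2 * U4 \<Phi> p)) \<and>
        (\<forall>V1 V2.
          (\<forall>p\<in>D. 2 * \<mu> * V1 p = \<mu> / (lam + \<mu>) * U1 \<Phi> p - (lam + 2 * \<mu>) / (lam + \<mu>) * U4 \<Phi> p \<and>
                  2 * \<mu> * V2 p = \<mu> / (lam + \<mu>) * U1 \<Phi> p + lam / (lam + \<mu>) * U4 \<Phi> p)
          \<longrightarrow> problem_ux_vy D lam \<mu> g1 g2 V1 V2) \<and>
        (\<forall>V1 V2. problem_ux_vy D lam \<mu> g1 g2 V1 V2 \<longrightarrow>
          (\<forall>p\<in>closure D.
            2 * \<mu> * cl_ext D V1 p =
              \<mu> / (lam + \<mu>) * cl_ext D (U1 \<Phi>) p - (lam + 2 * \<mu>) / (lam + \<mu>) * cl_ext D (U4 \<Phi>) p \<and>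
            2 * \<mu> * cl_ext D V2 p =
              \<mu> / (lam + \<mu>) * cl_ext D (U1 \<Phi>) p + lam / (lam + \<mu>) * cl_ext D (U4 \<Phi>) p)))"
proof -
  note D = assms(1,5) and pos = assms(6,7)
  note airy = problem_ux_vy_airy[OF D pos]
  let ?u1 = "\<lambda>p. lam * g1 p + (lam + 2 * \<mu>) * g2 p" and ?u4 = "\<lambda>p. - \<mu> * g1 p + \<mu> * g2 p"
  have ii: "(\<exists>W. biharmonic_problem D lam \<mu> g1 g2 W \<and>
          (\<forall>p\<in>D. pdx (pdx W) p = U1 \<Phi> p \<and> pdy (pdy W) p = U1 \<Phi> p - 2 * U4 \<Phi> p)) \<and>
        (\<forall>W. biharmonic_problem D lam \<mu> g1 g2 W \<longrightarrow>
          (\<forall>p\<in>D. pdx (pdx W) p = U1 \<Phi> p \<and> pdy (pdy W) p = U1 \<Phi> p - 2 * U4 \<Phi> p)) \<and>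
        (\<forall>V1 V2.
          (\<forall>p\<in>D. 2 * \<mu> * V1 p = \<mu> / (lam + \<mu>) * U1 \<Phi> p - (lam + 2 * \<mu>) / (lam + \<mu>) * U4 \<Phi> p \<and>
                  2 * \<mu> * V2 p = \<mu> / (lam + \<mu>) * U1 \<Phi> p + lam / (lam + \<mu>) * U4 \<Phi> p)
          \<longrightarrow> problem_ux_vy D lam \<mu> g1 g2 V1 V2) \<and>
        (\<forall>V1 V2. problem_ux_vy D lam \<mu> g1 g2 V1 V2 \<longrightarrow>
          (\<forall>p\<in>closure D.
            2 * \<mu> * cl_ext D V1 p =
              \<mu> / (lam + \<mu>) * cl_ext D (U1 \<Phi>) p - (lam + 2 * \<mu>) / (lam + \<mu>) * cl_ext D (U4 \<Phi>) p \<and>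
            2 * \<mu> * cl_ext D V2 p =
              \<mu> / (lam + \<mu>) * cl_ext D (U1 \<Phi>) p + lam / (lam + \<mu>) * cl_ext D (U4 \<Phi>) p))"
    if Phi: "problem_1_4 D ?u1 ?u4 \<Phi>" for \<Phi>
  proof -
    have mono: "monogenic_on (zeta ` D) \<Phi>"
      and bv: "has_boundary_values D (U1 \<Phi>) ?u1" "has_boundary_values D (U4 \<Phi>) ?u4"
      using Phi unfolding problem_1_4_def has_boundary_values_iff[OF D(1)] by blast+
    obtain W where W: "biharmonic_on D W" "\<And>p. p \<in> D \<Longrightarrow> pdx (pdx W) p = U1 \<Phi> p"
      "\<And>p. p \<in> D \<Longrightarrow> pdy (pdy W) p = U1 \<Phi> p - 2 * U4 \<Phi> p"
      using monogenic_generates_biharmonic[OF D mono] by blast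
    have "has_boundary_values D (pdx (pdx W)) ?u1"
      by (rule has_boundary_values_linear[OF bv, where c = 1 and d = 0]) (simp_all add: W)
    \<comment> \<open>The data combine as
      \<open>u1 - 2 u4 = (lam + 2 mu) g1 + lam g2\<close>.\<close>
    moreover have "has_boundary_values D (pdy (pdy W)) (\<lambda>p. (lam + 2 * \<mu>) * g1 p + lam * g2 p)"
      by (rule has_boundary_values_linear[OF bv, where c = 1 and d = "-2"]) (simp_all add: W algebra_simps)
    ultimately have WP: "biharmonic_problem D lam \<mu> g1 g2 W"
      using W(1) by (simp add: biharmonic_problem_iff[OF D(1) pos])
    \<comment> \<open>Uniqueness transfers the formulas from the one \<open>W\<close> generated by
      \<open>\<Phi>\<close> to every solution of the biharmonic problem.\<close>
    have all: "pdx (pdx W') p = U1 \<Phi> p" "pdy (pdy W') p = U1 \<Phi> p - 2 * U4 \<Phi> p"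
      if "biharmonic_problem D lam \<mu> g1 g2 W'" "p \<in> D" for W' p
      using biharmonic_problem_unique[OF D assms(3,4) pos that(1) WP that(2)] W that(2) by simp_all
    \<comment> \<open>With \<open>lam = s - mu\<close> the denominators become the single positive
      variable \<open>s\<close>.\<close>
    obtain s where lam: "lam = s - \<mu>" and s: "s > 0"
      using pos(2) that[of "lam + \<mu>"] by simp
    have C: "C1 lam \<mu> W' p = \<mu> / (lam + \<mu>) * U1 \<Phi> p - (lam + 2 * \<mu>) / (lam + \<mu>) * U4 \<Phi> p"
      "C2 lam \<mu> W' p = \<mu> / (lam + \<mu>) * U1 \<Phi> p + lam / (lam + \<mu>) * U4 \<Phi> p"
      if "biharmonic_problem D lam \<mu> g1 g2 W'" "p \<in> D" for W' p
      unfolding C1_C2_eq all[OF that] kappa0_def lam using s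
      by (simp_all add: field_simps)
    \<comment> \<open>The final formulas applied to the data \<open>u1\<close>, \<open>u4\<close>
      return \<open>2 mu g1\<close> and \<open>2 mu g2\<close>; this extends them from
      \<open>D\<close> to the frontier.\<close>
    have fr: "2 * \<mu> * g1 p = \<mu> / (lam + \<mu>) * ?u1 p - (lam + 2 * \<mu>) / (lam + \<mu>) * ?u4 p"
      "2 * \<mu> * g2 p = \<mu> / (lam + \<mu>) * ?u1 p + lam / (lam + \<mu>) * ?u4 p" for p
      unfolding lam using s by (simp_all add: field_simps)
    have cl: "2 * \<mu> * cl_ext D V1 p =
              \<mu> / (lam + \<mu>) * cl_ext D (U1 \<Phi>) p - (lam + 2 * \<mu>) / (lam + \<mu>) * cl_ext D (U4 \<Phi>) p \<and>
            2 * \<mu> * cl_ext D V2 p =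
              \<mu> / (lam + \<mu>) * cl_ext D (U1 \<Phi>) p + lam / (lam + \<mu>) * cl_ext D (U4 \<Phi>) p"
      if V: "problem_ux_vy D lam \<mu> g1 g2 V1 V2" and p: "p \<in> closure D" for V1 V2 p
    proof (cases "p \<in> D")
      case True
      from V obtain W' where "biharmonic_problem D lam \<mu> g1 g2 W'"
        "2 * \<mu> * V1 p = C1 lam \<mu> W' p" "2 * \<mu> * V2 p = C2 lam \<mu> W' p"
        unfolding airy using True by blast
      with C[of W' p] True show ?thesis by (simp add: cl_ext_def)
    next
      case False
      then have "p \<in> frontier D" using p D(1) by (simp add: frontier_def interior_open)
      then have "cl_ext D V1 p = g1 p" "cl_ext D V2 p = g2 p"
        "cl_ext D (U1 \<Phi>) p = ?u1 p" "cl_ext D (U4 \<Phi>) p = ?u4 p"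
        using V Phi by (simp_all add: problem_ux_vy_def problem_1_4_def)
      with fr show ?thesis by metis
    qed
    show ?thesis
    proof (intro conjI allI impI ballI)
      show "\<exists>W. biharmonic_problem D lam \<mu> g1 g2 W \<and>
          (\<forall>p\<in>D. pdx (pdx W) p = U1 \<Phi> p \<and> pdy (pdy W) p = U1 \<Phi> p - 2 * U4 \<Phi> p)"
        using WP W by blast
      show "problem_ux_vy D lam \<mu> g1 g2 V1 V2"
        if "\<forall>p\<in>D. 2 * \<mu> * V1 p = \<mu> / (lam + \<mu>) * U1 \<Phi> p - (lam + 2 * \<mu>) / (lam + \<mu>) * U4 \<Phi> p \<and>
                  2 * \<mu> * V2 p = \<mu> / (lam + \<mu>) * U1 \<Phi> p + lam / (lam + \<mu>) * U4 \<Phi> p" for V1 V2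
        unfolding airy using that WP C[OF WP] by (metis (no_types, lifting))
    qed (use all cl in blast)+
  qed
  from airy ii show ?thesis by blast
qed

end
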